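(* Let $I,J\ge1$ be integers, $\nu=q^{-I}$, and let real $q,\alpha$ satisfy either $q\in(0,1)$ and $\alpha<-q^{-I-J+1}$, or $q>1$ and $-q^{-I-J+1}<\alpha<0$. Consider the stochastic higher spin six vertex (SHS6V) model with these parameters and its height function $H$. For $x,y\in\mathbb Z_{\ge0}$ define $$\xi(x+1,y+1)=q^{H(x+1,y+1)}-\frac{\alpha+\nu}{1+\alpha}q^{H(x,y+1)}-\frac{1+\alpha q^J}{1+\alpha}q^{H(x+1,y)}+\frac{\nu+\alpha q^J}{1+\alpha}q^{H(x,y)}.$$ Then for all $x,y\in\mathbb Z_{\ge0}$, $$\mathbb E\big[\xi(x+1,y+1)\,\big|\,\mathcal F(x,y)\big]=0,$$ where $\mathcal F(x,y)=\sigma\big(H(i,j): i\le x\text{ or }j\le y\big)$ (with $i,j\in\mathbb Z_{\ge 0}$).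
   Context: $q$-Pochhammer symbols: $(a;q)_n=\prod_{k=0}^{n-1}(1-aq^k)$ for $n\ge0$ and $(a;q)_n=\prod_{k=1}^{-n}(1-aq^{-k})^{-1}$ for $n<0$. Regularized terminating basic hypergeometric series: $${}_{r+1}\bar\phi_r\Big(\begin{matrix}q^{-n};a_1,\dots,a_r\\ b_1,\dots,b_r\end{matrix}\Big|q,z\Big)=\sum_{k=0}^n z^k\frac{(q^{-n};q)_k}{(q;q)_k}\prod_{i=1}^r(a_i;q)_k(b_iq^k;q)_{n-k}.$$ Vertex weights. Let $\nu=q^{-I}$. The matrix $L^{(J)}_\alpha$, with rows and columns indexed by $\{0,\dots,I\}\times\{0,\dots,J\}$, is $$L^{(J)}_\alpha(i_1,j_1;i_2,j_2)=\mathbf 1_{\{i_1+j_1=i_2+j_2\}}\,q^{\frac{2j_1-j_1^2}{4}-\frac{2j_2-j_2^2}{4}+\frac{i_2^2+i_1^2}{4}+\frac{i_2(j_2-1)+i_1j_1}{2}}\,\frac{\nu^{j_1-i_2}\alpha^{j_2-j_1+i_2}(-\alpha\nu^{-1};q)_{j_2-i_1}}{(q;q)_{i_2}(-\alpha;q)_{i_2+j_2}(q^{J+1-j_1};q)_{j_1-j_2}}\;{}_4\bar\phi_3\Big(\begin{matrix}q^{-i_2};q^{-i_1},-\alpha q^J,-q\nu\alpha^{-1}\\ \nu,\,q^{1+j_2-i_1},\,q^{J+1-i_2-j_2}\end{matrix}\Big|q,q\Big).$$ Under the stated conditions on $q,\alpha$ it is a stochastic matrix (nonnegative entries, rows summing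 to 1). SHS6V model. Boundary data are $v_{x,0}\in\{0,\dots,I\}$ $(x\in\mathbb Z_{\ge0})$ and $h_{0,y}\in\{0,\dots,J\}$ $(y\in\mathbb Z_{\ge0})$. Going through the vertices $(x,y)\in\mathbb Z_{\ge0}^2$ sequentially along the successive diagonals $x+y=\text{const}$, given the numbers $v_{x,y}$ and $h_{x,y}$ of lines entering $(x,y)$ from the bottom and from the left, one samples the numbers $(v_{x,y+1},h_{x+1,y})$ of lines leaving to the top and to the right with probability $L^{(J)}_\alpha(v_{x,y},h_{x,y};\,\cdot,\cdot)$, independently of everything else given $(v_{x,y},h_{x,y})$. The height function is $$H(x,y)=\sum_{j=1}^y h_{0,j-1}-\sum_{i=1}^x v_{i-1,y},\qquad x,y\in\mathbb Z_{\ge0},$$ so $H(0,0)=0$, $H(x+1,y)-H(x,y)=-v_{x,y}$, $H(x,y+1)-H(x,y)=h_{x,y}$. *)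

theory Defs
  imports "HOL-Probability.Probability"
begin

definition qpoch :: "real \<Rightarrow> real \<Rightarrow> int \<Rightarrow> real" where
  "qpoch a q n =
     (if n \<ge> 0 then (\<Prod>k<nat n. 1 - a * q ^ k)
      else (\<Prod>k=1..nat (- n). inverse (1 - a * q powi (- int k))))"

(* Regularized terminating series with upper parameters q^(-n), as!0, as!1, ... and lower
   parameters bs!0, bs!1, ...; the two lists are meant to have the same length r. *)
definition phi_bar :: "nat \<Rightarrow> real list \<Rightarrow> real list \<Rightarrow> real \<Rightarrow> real \<Rightarrow> real" where
  "phi_bar n as bs q z =
     (\<Sum>k=0..n. z ^ k * (qpoch (q powi (- int n)) q (int k) / qpoch q q (int k)) *
        (\<Prod>i<length as. qpoch (as ! i) q (int k) * qpoch (bs ! i * q ^ k) q (int n - int k)))"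

definition nu :: "nat \<Rightarrow> real \<Rightarrow> real" where
  "nu I q = q powi (- int I)"

(* The row (i1, j1) is the input (from the bottom, from the left), the column (i2, j2) is the
   output (to the top, to the right). Exponents of q in quarters are real powers (q > 0); the
   powers of nu and of the negative number \<alpha> are integer powers. *)
definition vertex_weight ::
    "nat \<Rightarrow> nat \<Rightarrow> real \<Rightarrow> real \<Rightarrow> nat \<Rightarrow> nat \<Rightarrow> nat \<Rightarrow> nat \<Rightarrow> real" where
  "vertex_weight I J q \<alpha> i1 j1 i2 j2 =
     (if i1 + j1 = i2 + j2 then
        q powr ((2 * real j1 - real j1 ^ 2) / 4 - (2 * real j2 - real j2 ^ 2) / 4
                + (real i2 ^ 2 + real i1 ^ 2) / 4
                + (real i2 * (real j2 - 1) + real i1 * real j1) / 2)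
        * (nu I q powi (int j1 - int i2) * \<alpha> powi (int j2 - int j1 + int i2)
             * qpoch (- \<alpha> * inverse (nu I q)) q (int j2 - int i1)
           / (qpoch q q (int i2) * qpoch (- \<alpha>) q (int i2 + int j2)
              * qpoch (q powi (int J + 1 - int j1)) q (int j1 - int j2)))
        * phi_bar i2
            [q powi (- int i1), - \<alpha> * q ^ J, - q * nu I q * inverse \<alpha>]
            [nu I q, q powi (1 + int j2 - int i1), q powi (int J + 1 - int i2 - int j2)]
            q q
      else 0)"

(* The sigma-algebra generated by a set of random variables with values in a countable discrete
   space; all subsets of the target space are measurable. *)
definition generated_by :: "'a measure \<Rightarrow> ('a \<Rightarrow> 'b) set \<Rightarrow> 'a measure" where
  "generated_by M S = sigma (space M) {X -` A \<inter> space M | X A. X \<in> S}"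

(* v x y and h x y are the numbers of lines entering the vertex (x, y) from the bottom and from
   the left, so the lines leaving it are v x (y + 1) and h (x + 1) y. The following is generated
   by the boundary data and by the outputs of all vertices (i, j) different from (x, y) with
   i + j \<le> x + y: everything sampled on earlier diagonals, and the rest of the diagonal of (x, y). *)
definition sampled_before ::
    "'a measure \<Rightarrow> (nat \<Rightarrow> nat \<Rightarrow> 'a \<Rightarrow> nat) \<Rightarrow> (nat \<Rightarrow> nat \<Rightarrow> 'a \<Rightarrow> nat) \<Rightarrow> nat \<Rightarrow> nat \<Rightarrow> 'a measure"
  where
  "sampled_before M v h x y = generated_by M
     ({v i 0 | i. True} \<union> {h 0 j | j. True}
      \<union> {v i (j + 1) | i j. i + j \<le> x + y \<and> (i, j) \<noteq> (x, y)}
      \<union> {h (i + 1) j | i j. i + j \<le> x + y \<and> (i, j) \<noteq> (x, y)})"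

(* The boundary data v x 0, h 0 y may be random (with any joint law); deterministic boundary data
   are the constant random variables. Since sampled_before contains the boundary data and the
   other outputs on the same diagonal, the axiom sampling says both that the outputs have
   the prescribed law and that they are independent of everything else given the inputs. *)
locale shs6v = prob_space M
  for M :: "'a measure" +
  fixes I J :: nat and q \<alpha> :: real
    and v h :: "nat \<Rightarrow> nat \<Rightarrow> 'a \<Rightarrow> nat"
  assumes v_range: "\<And>x y. v x y \<in> measurable M (count_space {0..I})"
    and h_range: "\<And>x y. h x y \<in> measurable M (count_space {0..J})"
    and sampling: "\<And>x y i2 j2. i2 \<le> I \<Longrightarrow> j2 \<le> J \<Longrightarrow>
      AE \<omega> in M.
        real_cond_exp M (sampled_before M v h x y)
          (indicator {\<omega> \<in> space M. v x (y + 1) \<omega> = i2 \<and> h (x + 1) y \<omega> = j2}) \<omega>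
        = vertex_weight I J q \<alpha> (v x y \<omega>) (h x y \<omega>) i2 j2"

definition height ::
    "(nat \<Rightarrow> nat \<Rightarrow> 'a \<Rightarrow> nat) \<Rightarrow> (nat \<Rightarrow> nat \<Rightarrow> 'a \<Rightarrow> nat) \<Rightarrow> nat \<Rightarrow> nat \<Rightarrow> 'a \<Rightarrow> int" where
  "height v h x y \<omega> =
     (\<Sum>j=1..y. int (h 0 (j - 1) \<omega>)) - (\<Sum>i=1..x. int (v (i - 1) y \<omega>))"

(* \<xi>(x, y) is only meant for x, y \<ge> 1, because of the truncated subtraction. *)
definition xi ::
    "nat \<Rightarrow> nat \<Rightarrow> real \<Rightarrow> real \<Rightarrow> (nat \<Rightarrow> nat \<Rightarrow> 'a \<Rightarrow> int) \<Rightarrow> nat \<Rightarrow> nat \<Rightarrow> 'a \<Rightarrow> real" where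
  "xi I J q \<alpha> H x y \<omega> =
     q powi H x y \<omega>
     - (\<alpha> + nu I q) / (1 + \<alpha>) * q powi H (x - 1) y \<omega>
     - (1 + \<alpha> * q ^ J) / (1 + \<alpha>) * q powi H x (y - 1) \<omega>
     + (nu I q + \<alpha> * q ^ J) / (1 + \<alpha>) * q powi H (x - 1) (y - 1) \<omega>"

definition filt :: "'a measure \<Rightarrow> (nat \<Rightarrow> nat \<Rightarrow> 'a \<Rightarrow> int) \<Rightarrow> nat \<Rightarrow> nat \<Rightarrow> 'a measure" where
  "filt M H x y = generated_by M {H i j | i j. i \<le> x \<or> j \<le> y}"

end

theory Submission
  imports Defs
begin

text \<open>
  Expand the series in the vertex weight with summation index \<open>k\<close> and put \<open>i\<^sub>2 = k + l\<close>. After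
  cancellation the weight becomes a sum of products of two \<open>q\<close>-Vandermonde summands, one in
  \<open>l \<le> j\<^sub>1\<close> (for fixed \<open>k\<close>) and one in \<open>k \<le> i\<^sub>1\<close>. Two applications of the \<open>q\<close>-Chu-Vandermonde sum,
  with the extra factor \<open>q\<^sup>-\<^sup>l\<close> or \<open>q\<^sup>-\<^sup>k\<close>, evaluate the mean of \<open>q\<close> to the power \<open>- i\<^sub>2\<close> under the
  weights, and this is exactly what makes \<open>\<xi>\<close> centred given the vertices sampled before \<open>(x, y)\<close>.

  The \<open>\<sigma>\<close>-algebra of the theorem also contains vertices \<open>(a, b)\<close> with \<open>a < x\<close> or \<open>b < y\<close> on later
  diagonals. These are added one at a time: the inputs of such a vertex come from vertices of the
  same region, and its outputs depend on the rest, \<open>\<xi>\<close> included, through these inputs only,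
  so \<open>\<xi>\<close> remains orthogonal to the enlarged \<open>\<sigma>\<close>-algebra.
\<close>

subsection \<open>The \<open>q\<close>-Chu-Vandermonde sum\<close>

lemma qpoch_of_nat: "qpoch a q (int n) = (\<Prod>k<n. 1 - a * q ^ k)"
  by (simp add: qpoch_def)

lemma qpoch_0 [simp]: "qpoch a q 0 = 1"
  by (simp add: qpoch_def)

lemma qpoch_Suc: "qpoch a q (int (Suc n)) = qpoch a q (int n) * (1 - a * q ^ n)"
  unfolding qpoch_of_nat by simp

lemma qpoch_add:
  "qpoch a q (int (m + n)) = qpoch a q (int m) * qpoch (a * q ^ m) q (int n)"
  by (induction n) (simp_all only: add_0_right add_Suc_right qpoch_Suc power_add, simp_all add: mult_ac)

text \<open>Reading the product from the other end turns its factors into those of an ordinary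
  symbol based at \<open>a * q powi (- int n)\<close>. Vanishing factors are covered by
  \<open>inverse 0 = 0\<close>.\<close>

lemma qpoch_minus_of_nat:
  assumes "q \<noteq> 0"
  shows "qpoch a q (- int n) = inverse (qpoch (a * q powi (- int n)) q (int n))"
proof (cases "n = 0")
  case False
  then have "qpoch a q (- int n) = (\<Prod>k=1..n. inverse (1 - a * q powi (- int k)))"
    by (simp add: qpoch_def)
  also have "\<dots> = (\<Prod>k<n. inverse (1 - a * q powi (- int n) * q ^ k))"
  proof (rule prod.reindex_bij_witness[of _ "\<lambda>k. n - k" "\<lambda>k. n - k"], goal_cases)
    case (5 k)
    then have "q powi (- int k) = q powi (- int n) * q powi (int (n - k))"
      using assms by (subst power_int_add [symmetric]) auto
    then show ?case by (simp add: mult_ac)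
  qed auto
  finally show ?thesis using prod_inversef[of "\<lambda>k. 1 - a * q powi (- int n) * q ^ k" "{..<n}"]
    by (simp add: qpoch_of_nat o_def)
qed simp

lemma qpoch_nonzero:
  assumes "\<And>k. k < n \<Longrightarrow> a * q ^ k \<noteq> 1"
  shows "qpoch a q (int n) \<noteq> 0"
  using assms by (force simp: qpoch_of_nat)

lemma qpoch_eq_0:
  assumes "k < n" "a * q ^ k = 1"
  shows "qpoch a q (int n) = 0"
  using assms by (auto simp: qpoch_of_nat)

lemma power_ne_1_real:
  fixes q :: real
  assumes "q > 0" "q \<noteq> 1" "n > 0"
  shows "q ^ n \<noteq> 1"
  using assms power_eq_1_iff[of q n] by auto

lemma qpoch_q_nonzero:
  assumes "(q::real) > 0" "q \<noteq> 1"
  shows "qpoch q q (int n) \<noteq> 0"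
  by (rule qpoch_nonzero) (metis assms power_Suc power_ne_1_real zero_less_Suc)

text \<open>Each factor is turned around by
  \<open>1 - q / a * q ^ k = - (q ^ Suc k / a) * (1 - a / q ^ Suc k)\<close>. The turned factors
  appear in reverse order, so the induction step adds one at the front of the symbol on the
  right.\<close>

lemma qpoch_reflect:
  assumes "q > 0" "a \<noteq> 0"
  shows "qpoch (q / a) q (int k) =
    (- 1 / a) ^ k * q powr (real k * (real k + 1) / 2) * qpoch (a * q powr (- real k)) q (int k)"
proof (induction k)
  case (Suc k)
  have 1: "qpoch (a * q powr (- real (Suc k))) q (int (Suc k)) =
     (1 - a * q powr (- real (Suc k))) * qpoch (a * q powr (- real k)) q (int k)"
  proof -
    have *: "a * q powr (- real (Suc k)) * q ^ 1 = a * q powr (- real k)"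
      using powr_add[of q "- real (Suc k)" 1] assms by simp
    show ?thesis
      using qpoch_add[of "a * q powr (- real (Suc k))" q 1 k, unfolded *]
        qpoch_Suc[of "a * q powr (- real (Suc k))" q 0]
      by (simp only: add_Suc add_0 of_nat_0 qpoch_0 One_nat_def power_0 mult_1 mult_1_right)
  qed
  have 2: "1 - q / a * q ^ k = (- 1 / a) * q powr (real (Suc k)) * (1 - a * q powr (- real (Suc k)))"
  proof -
    have "(- 1 / a) * P * (1 - a * P') = P * P' - P / a" for P P' :: real
      using assms by (simp add: field_simps)
    moreover have "q powr real (Suc k) * q powr (- real (Suc k)) = 1"
      using assms by (simp flip: powr_add)
    moreover have "q powr real (Suc k) = q * q ^ k"
      using assms powr_realpow[of q "Suc k"] by simp
    ultimately show ?thesis by simp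
  qed
  have 3: "q powr (real k * (real k + 1) / 2) * q powr (real (Suc k)) =
     q powr (real (Suc k) * (real (Suc k) + 1) / 2)"
    unfolding powr_add[symmetric] by (simp add: field_simps)
  show ?case
    unfolding qpoch_Suc[of "q / a"] Suc.IH 1 2 3[symmetric] by simp
qed (use assms in simp)

section \<open>Convolutions of two \<open>q\<close>-binomial series\<close>

text \<open>\<open>S n\<close> is the coefficient of \<open>z ^ n\<close> in the product of two
  \<open>q\<close>-binomial series, in \<open>z\<close> and in \<open>x * z\<close>. The factor
  \<open>1 - q ^ Suc n\<close> is shared out so that it cancels a denominator of either series. The
  free \<open>x\<close> is later specialized to \<open>a\<close> and to
  \<open>a * q\<close>.\<close>

lemma q_convolution_rec:
  fixes a b x q :: real
  defines "S \<equiv> \<lambda>n. \<Sum>l\<le>n. qpoch a q (int l) / qpoch q q (int l)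
      * (qpoch b q (int (n - l)) / qpoch q q (int (n - l))) * x ^ (n - l)"
  assumes q: "q > 0" "q \<noteq> 1"
  shows "(1 - q ^ Suc n) * S (Suc n) =
    (\<Sum>l\<le>n. qpoch a q (int l) / qpoch q q (int l)
      * (qpoch b q (int (n - l)) / qpoch q q (int (n - l))) * x ^ (n - l)
      * (1 - a * q ^ l + x * q ^ l - x * b * q ^ n))"
proof -
  define u where "u l = qpoch a q (int l) / qpoch q q (int l)" for l
  define w where "w l = qpoch b q (int l) / qpoch q q (int l)" for l
  have uS: "u (Suc l) * (1 - q ^ Suc l) = u l * (1 - a * q ^ l)" for l
    using power_ne_1_real[OF q, of "Suc l"] unfolding u_def qpoch_Suc
    by (simp add: field_simps qpoch_q_nonzero q)
  have wS: "w (Suc l) * (1 - q ^ Suc l) = w l * (1 - b * q ^ l)" for l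
    using power_ne_1_real[OF q, of "Suc l"] unfolding w_def qpoch_Suc
    by (simp add: field_simps qpoch_q_nonzero q)
  \<comment> \<open>The split is
    \<open>1 - q ^ Suc n = (1 - q ^ l) + q ^ l * (1 - q ^ (Suc n - l))\<close>: the first part
    lowers the index of \<open>u\<close>, the second that of \<open>w\<close>.\<close>
  have "(1 - q ^ Suc n) * S (Suc n) =
      (\<Sum>l\<le>Suc n. (1 - q ^ l) * (u l * w (Suc n - l) * x ^ (Suc n - l)))
      + (\<Sum>l\<le>Suc n. q ^ l * (1 - q ^ (Suc n - l)) * (u l * w (Suc n - l) * x ^ (Suc n - l)))"
    unfolding S_def u_def[symmetric] w_def[symmetric] sum_distrib_left sum.distrib[symmetric]
  proof (rule sum.cong)
    fix l assume "l \<in> {..Suc n}"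
    then have "q ^ Suc n = q ^ l * q ^ (Suc n - l)" by (simp flip: power_add)
    then have *: "1 - q ^ Suc n = (1 - q ^ l) + q ^ l * (1 - q ^ (Suc n - l))"
      by (simp add: algebra_simps del: power_Suc)
    show "(1 - q ^ Suc n) * (u l * w (Suc n - l) * x ^ (Suc n - l)) =
      (1 - q ^ l) * (u l * w (Suc n - l) * x ^ (Suc n - l)) +
         q ^ l * (1 - q ^ (Suc n - l)) * (u l * w (Suc n - l) * x ^ (Suc n - l))"
      unfolding * by (simp only: ring_distribs mult.assoc)
  qed simp
  \<comment> \<open>The factor \<open>1 - q ^ l\<close> kills \<open>l = 0\<close>, so the index can
    be shifted; in the other sum it is \<open>l = Suc n\<close> that drops out.\<close>
  also have "(\<Sum>l\<le>Suc n. (1 - q ^ l) * (u l * w (Suc n - l) * x ^ (Suc n - l))) =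
      (\<Sum>l\<le>n. u l * w (n - l) * x ^ (n - l) * (1 - a * q ^ l))"
    unfolding sum.atMost_Suc_shift
  proof (simp del: power_Suc, rule sum.cong)
    fix l
    have "(1 - q ^ Suc l) * (u (Suc l) * w (n - l) * x ^ (n - l)) =
         (u (Suc l) * (1 - q ^ Suc l)) * (w (n - l) * x ^ (n - l))"
      by (simp only: mult_ac)
    then show "(1 - q ^ Suc l) * (u (Suc l) * w (n - l) * x ^ (n - l)) =
         u l * w (n - l) * x ^ (n - l) * (1 - a * q ^ l)"
      unfolding uS by (simp only: mult_ac)
  qed simp
  also have "(\<Sum>l\<le>Suc n. q ^ l * (1 - q ^ (Suc n - l)) * (u l * w (Suc n - l) * x ^ (Suc n - l))) =
      (\<Sum>l\<le>n. u l * w (n - l) * x ^ (n - l) * (x * q ^ l - x * b * q ^ n))"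
    unfolding sum.atMost_Suc
  proof (simp del: power_Suc, rule sum.cong)
    fix l assume l: "l \<in> {..n}"
    then have "q ^ n = q ^ l * q ^ (n - l)" by (simp flip: power_add)
    moreover have "Suc n - l = Suc (n - l)" using l by auto
    ultimately have "q ^ l * (1 - q ^ (Suc n - l)) * (u l * w (Suc n - l) * x ^ (Suc n - l)) =
        (w (Suc (n - l)) * (1 - q ^ Suc (n - l))) * (q ^ l * u l * (x * x ^ (n - l)))"
      by (simp only: power_Suc[of x] mult_ac)
    then show "q ^ l * (1 - q ^ (Suc n - l)) * (u l * w (Suc n - l) * x ^ (Suc n - l)) =
        u l * w (n - l) * x ^ (n - l) * (x * q ^ l - x * b * q ^ n)"
      unfolding wS \<open>q ^ n = _\<close> by (simp add: algebra_simps)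
  qed simp
  finally show ?thesis
    unfolding u_def[symmetric] w_def[symmetric]
    by (simp add: sum.distrib[symmetric] algebra_simps)
qed

text \<open>For \<open>x = a\<close> the bracket in \<open>q_convolution_rec\<close> collapses to
  \<open>1 - a * b * q ^ n\<close>, free of \<open>l\<close>, so both sides obey the same
  first-order recursion.\<close>

lemma q_chu_vandermonde:
  fixes a b q :: real
  assumes q: "q > 0" "q \<noteq> 1"
  shows "(\<Sum>l\<le>n. qpoch a q (int l) / qpoch q q (int l)
      * (qpoch b q (int (n - l)) / qpoch q q (int (n - l))) * a ^ (n - l))
    = qpoch (a * b) q (int n) / qpoch q q (int n)"
proof (induction n)
  case (Suc n)
  have "(1 - q ^ Suc n) * (\<Sum>l\<le>Suc n. qpoch a q (int l) / qpoch q q (int l)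
      * (qpoch b q (int (Suc n - l)) / qpoch q q (int (Suc n - l))) * a ^ (Suc n - l)) =
      (1 - a * b * q ^ n) * (qpoch (a * b) q (int n) / qpoch q q (int n))"
    unfolding q_convolution_rec[OF q] Suc.IH[symmetric]
    unfolding sum_distrib_left by (rule sum.cong) (simp_all only: mult_ac diff_add_cancel)
  then show ?case
    using power_ne_1_real[OF q, of "Suc n"] qpoch_q_nonzero[OF q] unfolding qpoch_Suc
    by (simp add: field_simps)
qed simp

text \<open>The extra weight \<open>q ^ (n - l)\<close> gives, after division by
  \<open>q ^ n\<close>, the moment of \<open>q\<close> to the power \<open>- l\<close>. For
  \<open>x = a * q\<close> the bracket is \<open>1 - a * b * q ^ Suc n\<close> minus
  \<open>a * (1 - q) * q ^ l\<close>, and the second part leads back to the plain sum. The factor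
  \<open>1 - a * b\<close> avoids a division by it.\<close>

lemma q_chu_vandermonde_moment:
  fixes a b q :: real
  assumes q: "q > 0" "q \<noteq> 1"
  shows "(1 - a * b) * (\<Sum>l\<le>n. qpoch a q (int l) / qpoch q q (int l)
      * (qpoch b q (int (n - l)) / qpoch q q (int (n - l))) * (a * q) ^ (n - l))
    = qpoch (a * b) q (int n) / qpoch q q (int n) * (1 - a * b * q ^ n - a + a * q ^ n)"
proof (induction n)
  case (Suc n)
  let ?F = "qpoch (a * b) q (int n) / qpoch q q (int n)"
  let ?t = "\<lambda>n x l. qpoch a q (int l) / qpoch q q (int l)
      * (qpoch b q (int (n - l)) / qpoch q q (int (n - l))) * x ^ (n - l)"
  let ?S = "\<lambda>n. (\<Sum>l\<le>n. ?t n (a * q) l)"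
  have "(1 - q ^ Suc n) * ?S (Suc n) =
     (\<Sum>l\<le>n. (1 - a * b * q ^ Suc n) * ?t n (a * q) l - a * (1 - q) * q ^ n * ?t n a l)"
    unfolding q_convolution_rec[OF q]
  proof (rule sum.cong)
    fix l assume "l \<in> {..n}"
    \<comment> \<open>With this, \<open>q ^ l * (a * q) ^ (n - l)\<close> becomes
      \<open>q ^ n * a ^ (n - l)\<close>, which belongs to the plain sum.\<close>
    then have "q ^ n = q ^ l * q ^ (n - l)" by (simp flip: power_add)
    define c where "c = qpoch a q (int l) / qpoch q q (int l)
      * (qpoch b q (int (n - l)) / qpoch q q (int (n - l)))"
    show "?t n (a * q) l * (1 - a * q ^ l + a * q * q ^ l - a * q * b * q ^ n) =
      (1 - a * b * q ^ Suc n) * ?t n (a * q) l - a * (1 - q) * q ^ n * ?t n a l"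
      unfolding c_def[symmetric] power_mult_distrib power_Suc \<open>q ^ n = _\<close>
      by (simp add: algebra_simps)
  qed simp
  also have "\<dots> = (1 - a * b * q ^ Suc n) * ?S n - a * (1 - q) * q ^ n * ?F"
    unfolding sum_subtractf sum_distrib_left[symmetric] q_chu_vandermonde[OF q] ..
  finally have 1: "(1 - q ^ Suc n) * ?S (Suc n) =
      (1 - a * b * q ^ Suc n) * ?S n - a * (1 - q) * q ^ n * ?F" .
  have "(1 - q ^ Suc n) * ((1 - a * b) * ?S (Suc n)) =
     (1 - a * b * q ^ Suc n) * ((1 - a * b) * ?S n) - (1 - a * b) * (a * (1 - q) * q ^ n * ?F)"
    unfolding mult.left_commute[of "1 - q ^ Suc n"] 1 by (simp only: right_diff_distrib mult_ac)
  also have "\<dots> = ?F * (1 - a * b * q ^ n) * (1 - a * b * q ^ Suc n - a + a * q ^ Suc n)"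
    unfolding Suc.IH by (simp, algebra)
  finally have "(1 - q ^ Suc n) * ((1 - a * b) * ?S (Suc n)) =
    ?F * (1 - a * b * q ^ n) * (1 - a * b * q ^ Suc n - a + a * q ^ Suc n)" .
  then show ?case
    using power_ne_1_real[OF q, of "Suc n"] qpoch_q_nonzero[OF q] unfolding qpoch_Suc
    by (simp only: times_divide_eq_left) (simp add: field_simps)
qed simp

subsection \<open>The first moment of the vertex weights\<close>

lemma powi_eq_powr: "q > 0 \<Longrightarrow> q powi n = q powr real_of_int n"
  by (simp add: powr_real_of_int')

lemma powr_power_real: "(q::real) > 0 \<Longrightarrow> (q powr x) ^ n = q powr (x * real n)"
  by (simp add: powr_powr flip: powr_realpow)

text \<open>Reflection with base \<open>q powr (real (k + l) + 1)\<close>: the turned symbol starts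
  at \<open>q * q ^ l\<close> and so continues \<open>qpoch q q (int l)\<close>. It treats the two
  upper parameters that are negative powers of \<open>q\<close>.\<close>

lemma qpoch_neg_power:
  assumes q: "q > 0"
  shows "qpoch (q powr (- real (k + l))) q (int k) * qpoch q q (int l) =
    (- 1) ^ k * q powr (real k * (real k - 1) / 2 - real (k + l) * real k) * qpoch q q (int (k + l))"
proof -
  let ?a = "q powr (real (k + l) + 1)"
  have 1: "q / ?a = q powr (- real (k + l))"
    using q powr_add[of q "- real (k + l)" "real (k + l) + 1"] by (simp add: field_simps)
  have 2: "?a * q powr (- real k) = q * q ^ l"
    using q by (simp flip: powr_add powr_realpow) (simp add: powr_add)
  have 3: "(- 1 / ?a) ^ k = (- 1) ^ k * q powr (- (real (k + l) + 1) * real k)"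
  proof -
    have "- 1 / ?a = - 1 * q powr (- (real (k + l) + 1))"
      unfolding powr_minus_divide by simp
    then show ?thesis by (simp only: power_mult_distrib powr_power_real[OF q])
  qed
  have 4: "q powr (- (real (k + l) + 1) * real k) * q powr (real k * (real k + 1) / 2) =
     q powr (real k * (real k - 1) / 2 - real (k + l) * real k)"
    unfolding powr_add[symmetric] by (simp add: field_simps)
  have "qpoch (q powr (- real (k + l))) q (int k) * qpoch q q (int l) =
     (- 1) ^ k * (q powr (- (real (k + l) + 1) * real k) * q powr (real k * (real k + 1) / 2)) *
     (qpoch q q (int l) * qpoch (q * q ^ l) q (int k))"
    using qpoch_reflect[OF q, of ?a k] q unfolding 1 2 3 by (simp only: mult_ac) simp
  then show ?thesis
    unfolding 4 qpoch_add[symmetric] by (simp add: add.commute)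
qed

text \<open>Reflection with base \<open>q powr (c + real r)\<close>, meant for the third lower
  parameter of the series, where \<open>c = real j1 - real J\<close>.\<close>

lemma qpoch_reverse_power:
  assumes q: "q > 0"
  shows "qpoch (q powr (1 - c - real r)) q (int r) =
    (- 1) ^ r * q powr (- c * real r - real r * (real r - 1) / 2) * qpoch (q powr c) q (int r)"
proof -
  let ?a = "q powr (c + real r)"
  have 1: "q / ?a = q powr (1 - c - real r)"
    using q by (simp add: powr_add powr_diff field_simps)
  have 2: "?a * q powr (- real r) = q powr c"
    using q by (simp flip: powr_add)
  have 3: "(- 1 / ?a) ^ r = (- 1) ^ r * q powr (- (c + real r) * real r)"
  proof -
    have "- 1 / ?a = - 1 * q powr (- (c + real r))"
      unfolding powr_minus_divide by simp
    then show ?thesis by (simp only: power_mult_distrib powr_power_real[OF q])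
  qed
  have 4: "q powr (- (c + real r) * real r) * q powr (real r * (real r + 1) / 2) =
     q powr (- c * real r - real r * (real r - 1) / 2)"
    unfolding powr_add[symmetric] by (simp add: field_simps)
  show ?thesis
    using qpoch_reflect[OF q, of ?a r] q unfolding 1 2 3 4[symmetric] by simp
qed

text \<open>By reflection the second symbol is, up to a power, the one of length \<open>k\<close>
  based at \<open>a * q powr (- real k)\<close>; the first symbol continues it, or cuts it back when
  \<open>n < k\<close>. In the latter case \<open>nz\<close> says that the factors taken away are
  nonzero.\<close>

lemma qpoch_int_diff_mult:
  assumes q: "q > 0" and a: "a \<noteq> 0"
    and nz: "\<And>t. n \<le> t \<Longrightarrow> t < k \<Longrightarrow> a * q powr (real t - real k) \<noteq> 1"
  shows "qpoch a q (int n - int k) * qpoch (q / a) q (int k) =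
    (- 1 / a) ^ k * q powr (real k * (real k + 1) / 2) * qpoch (a * q powr (- real k)) q (int n)"
proof (cases "k \<le> n")
  case True
  have "qpoch (a * q powr (- real k)) q (int n) =
      qpoch (a * q powr (- real k)) q (int k) * qpoch a q (int (n - k))"
    using qpoch_add[of "a * q powr (- real k)" q k "n - k"] True q
    by (simp add: powr_minus powr_realpow mult.assoc)
  then show ?thesis
    unfolding qpoch_reflect[OF q a] using True by (simp add: of_nat_diff)
next
  case False
  have 1: "a * q powi (- int (k - n)) = a * q powr (- real k) * q ^ n"
    using q False by (simp add: powi_eq_powr powr_realpow[symmetric] of_nat_diff powr_add[symmetric])
  have "qpoch (a * q powr (- real k) * q ^ n) q (int (k - n)) \<noteq> 0"
  proof (rule qpoch_nonzero)
    fix t assume "t < k - n"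
    then show "a * q powr (- real k) * q ^ n * q ^ t \<noteq> 1"
      using nz[of "n + t"] q
      by (simp add: powr_realpow[symmetric] powr_add[symmetric] mult.assoc algebra_simps)
  qed
  moreover have "qpoch a q (int n - int k) = inverse (qpoch (a * q powr (- real k) * q ^ n) q (int (k - n)))"
    using qpoch_minus_of_nat[of q a "k - n"] q False unfolding 1 by (simp add: of_nat_diff)
  moreover have "qpoch (a * q powr (- real k)) q (int k) =
      qpoch (a * q powr (- real k)) q (int n) * qpoch (a * q powr (- real k) * q ^ n) q (int (k - n))"
    using qpoch_add[of "a * q powr (- real k)" q n "k - n"] False by simp
  ultimately show ?thesis
    unfolding qpoch_reflect[OF q a] by simp
qed

text \<open>The summand of index \<open>k\<close> in the weight of the output \<open>i\<^sub>2 = k + l\<close>.\<close>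

definition weight_term :: "nat \<Rightarrow> nat \<Rightarrow> real \<Rightarrow> real \<Rightarrow> nat \<Rightarrow> nat \<Rightarrow> nat \<Rightarrow> nat \<Rightarrow> real" where
  "weight_term I J q \<alpha> i1 j1 k l =
     (qpoch q q (int i1) / qpoch (- \<alpha> * q ^ j1) q (int i1)
        * (qpoch (- \<alpha> * q ^ J) q (int k) / qpoch q q (int k)
           * (qpoch (q powr (real j1 - real J)) q (int (i1 - k)) / qpoch q q (int (i1 - k)))
           * (- \<alpha> * q ^ J) ^ (i1 - k)))
     * (qpoch q q (int j1) / qpoch (- \<alpha>) q (int j1)
        * (qpoch (nu I q * q ^ k) q (int l) / qpoch q q (int l)
           * (qpoch (- \<alpha> / (nu I q * q ^ k)) q (int (j1 - l)) / qpoch q q (int (j1 - l)))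
           * (nu I q * q ^ k) ^ (j1 - l)))"

text \<open>This collects the prefactor and all powers that reflecting the symbols of the series
  produces. With \<open>r = i1 - k\<close> and \<open>n = j1 - l\<close> the quadratic exponents
  cancel, and the exponent of \<open>q\<close> that survives, apart from the powers of
  \<open>nu I q\<close>, is \<open>J * r + k * n\<close>.\<close>

lemma weight_power_identity:
  fixes q \<alpha> :: real
  assumes q: "q > 0" and "\<alpha> \<noteq> 0" and k: "k \<le> i1" and l: "l \<le> j1" and s: "i1 + j1 = k + l + j2"
  shows "q powr ((2 * real j1 - real j1 ^ 2) / 4 - (2 * real j2 - real j2 ^ 2) / 4
                + (real (k + l) ^ 2 + real i1 ^ 2) / 4
                + (real (k + l) * (real j2 - 1) + real i1 * real j1) / 2)
      * (nu I q powi (int j1 - int (k + l)) * \<alpha> powi (int j2 - int j1 + int (k + l)))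
      * q ^ k
      * q powr (real k * (real k - 1) / 2 - real (k + l) * real k)
      * q powr (real k * (real k - 1) / 2 - real i1 * real k)
      * ((nu I q / \<alpha>) ^ k * q powr (real k * (real k + 1) / 2))
      * ((- 1) ^ (i1 - k) * q powr (- (real j1 - real J) * real (i1 - k) - real (i1 - k) * (real (i1 - k) - 1) / 2))
    = (- \<alpha> * q ^ J) ^ (i1 - k) * (nu I q * q ^ k) ^ (j1 - l)"
proof -
  define r n where "r = i1 - k" and "n = j1 - l"
  have i1: "i1 = k + r" and j1: "j1 = l + n" using k l by (auto simp: r_def n_def)
  have j2: "j2 = r + n" using s i1 j1 by simp
  have \<nu>: "nu I q \<noteq> 0" using q by (simp add: nu_def)
  have "nu I q powi (int j1 - int (k + l)) * nu I q ^ k = nu I q ^ n"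
    using \<nu> unfolding j1 by (simp add: power_int_diff power_int_add field_simps power_add)
  moreover have "\<alpha> powi (int j2 - int j1 + int (k + l)) = \<alpha> ^ k * \<alpha> ^ r"
  proof -
    have "int j2 - int j1 + int (k + l) = int (k + r)" using j1 j2 by simp
    then show ?thesis by (simp only: power_int_of_nat power_add)
  qed
  ultimately have A: "nu I q powi (int j1 - int (k + l)) * \<alpha> powi (int j2 - int j1 + int (k + l))
      * (nu I q / \<alpha>) ^ k = nu I q ^ n * \<alpha> ^ r"
    using \<open>\<alpha> \<noteq> 0\<close> by (simp add: power_divide)
  \<comment> \<open>Once \<open>i1 = k + r\<close>, \<open>j1 = l + n\<close> and
    \<open>j2 = r + n\<close> are substituted, this is a polynomial identity between
    exponents.\<close>
  have B: "q powr ((2 * real j1 - real j1 ^ 2) / 4 - (2 * real j2 - real j2 ^ 2) / 4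
                + (real (k + l) ^ 2 + real i1 ^ 2) / 4
                + (real (k + l) * (real j2 - 1) + real i1 * real j1) / 2)
      * q powr real k
      * q powr (real k * (real k - 1) / 2 - real (k + l) * real k)
      * q powr (real k * (real k - 1) / 2 - real i1 * real k)
      * q powr (real k * (real k + 1) / 2)
      * q powr (- (real j1 - real J) * real r - real r * (real r - 1) / 2)
    = q powr (real J * real r) * q powr (real k * real n)"
    unfolding powr_add[symmetric] i1 j1 j2
    by (rule arg_cong[of _ _ "(powr) q"]) (simp add: field_simps power2_eq_square)
  have "(- \<alpha> * q ^ J) ^ r * (nu I q * q ^ k) ^ n =
     (nu I q ^ n * \<alpha> ^ r) * (- 1) ^ r * (q powr (real J * real r) * q powr (real k * real n))"
    unfolding power_mult_distrib using q power_mult_distrib[of "- 1" \<alpha> r]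
    by (simp add: powr_powr[symmetric] powr_realpow)
  also have "\<dots> = (nu I q powi (int j1 - int (k + l)) * \<alpha> powi (int j2 - int j1 + int (k + l))
      * (nu I q / \<alpha>) ^ k) * (- 1) ^ r * (q powr ((2 * real j1 - real j1 ^ 2) / 4 - (2 * real j2 - real j2 ^ 2) / 4
                + (real (k + l) ^ 2 + real i1 ^ 2) / 4
                + (real (k + l) * (real j2 - 1) + real i1 * real j1) / 2)
      * q powr real k
      * q powr (real k * (real k - 1) / 2 - real (k + l) * real k)
      * q powr (real k * (real k - 1) / 2 - real i1 * real k)
      * q powr (real k * (real k + 1) / 2)
      * q powr (- (real j1 - real J) * real r - real r * (real r - 1) / 2))"
    unfolding A B ..
  finally show ?thesis
    unfolding r_def[symmetric] n_def[symmetric] powr_realpow[OF q] by (simp only: mult_ac)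
qed

text \<open>Pure field arithmetic, stated with letters so that simplification never looks inside the
  Pochhammer symbols. The letter \<open>s\<close> stands for the sign \<open>(- 1) ^ k\<close>, and
  \<open>R\<close> is supplied by \<open>weight_power_identity\<close>.\<close>

lemma fraction_rearrange:
  fixes P :: real
  assumes "D1 * D2 = e4 * Y" "BL / S = e6 * Z" "s * s = 1" "Qm \<noteq> 0"
    and R: "P * N * qk * e1 * e2 * e4 * e6 = R1 * R2"
  shows "P * (N * D1 / (Qm * (A1 * A2) * S))
      * (qk * (s * e1 * Qm / Ql / Qk) * (s * e2 * Qi / Qr * V * (W * (Qj / Qn) * (D2 * BL))))
    = (Qi / A2 * (W / Qk * (Z / Qr) * R1)) * (Qj / A1 * (V / Ql * (Y / Qn) * R2))" (is "?l = ?r")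
proof -
  have "?l = (P * N * qk * e1 * e2) * (s * s) * (D1 * D2) * (BL / S)
      * (V * W * Qi * Qj / (A1 * A2 * Ql * Qk * Qr * Qn))"
    using \<open>Qm \<noteq> 0\<close> by (simp add: mult_ac)
  also have "\<dots> = (P * N * qk * e1 * e2 * e4 * e6) * (Y * Z * (V * W * Qi * Qj / (A1 * A2 * Ql * Qk * Qr * Qn)))"
    unfolding assms(1-3) by simp
  also have "\<dots> = ?r" unfolding R by (simp add: mult_ac)
  finally show ?thesis .
qed

text \<open>The facts \<open>c1\<close> to \<open>c3\<close> turn symbols based at powers of
  \<open>q\<close> into quotients of symbols \<open>qpoch q q\<close>; \<open>c4\<close> and
  \<open>c5\<close> pair the two prefactors of possibly negative index with symbols of the series.
  What remains are the two Vandermonde summands.\<close>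

lemma phi_bar_summand:
  fixes q \<alpha> :: real
  assumes q: "q > 0" "q \<noteq> 1" and \<alpha>: "\<alpha> \<noteq> 0"
    and nz: "\<forall>t<I + J. \<alpha> * q ^ t \<noteq> - 1"
    and i1: "i1 \<le> I" and j1: "j1 \<le> J" and j2: "j2 \<le> J"
    and k: "k \<le> i1" and l: "l \<le> j1" and kl: "k + l \<le> I" and s: "i1 + j1 = k + l + j2"
  shows "q powr ((2 * real j1 - real j1 ^ 2) / 4 - (2 * real j2 - real j2 ^ 2) / 4
                + (real (k + l) ^ 2 + real i1 ^ 2) / 4
                + (real (k + l) * (real j2 - 1) + real i1 * real j1) / 2)
        * (nu I q powi (int j1 - int (k + l)) * \<alpha> powi (int j2 - int j1 + int (k + l))
             * qpoch (- \<alpha> * inverse (nu I q)) q (int j2 - int i1)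
           / (qpoch q q (int (k + l)) * qpoch (- \<alpha>) q (int (k + l) + int j2)
              * qpoch (q powi (int J + 1 - int j1)) q (int j1 - int j2)))
        * (q ^ k * (qpoch (q powi (- int (k + l))) q (int k) / qpoch q q (int k))
           * (qpoch (q powi (- int i1)) q (int k) * qpoch (nu I q * q ^ k) q (int (k + l) - int k)
            * (qpoch (- \<alpha> * q ^ J) q (int k) * qpoch (q powi (1 + int j2 - int i1) * q ^ k) q (int (k + l) - int k)
            * (qpoch (- q * nu I q * inverse \<alpha>) q (int k)
               * qpoch (q powi (int J + 1 - int (k + l) - int j2) * q ^ k) q (int (k + l) - int k)))))
      = weight_term I J q \<alpha> i1 j1 k l"
proof -
  let ?\<nu> = "nu I q"
  define r n where "r = i1 - k" and "n = j1 - l"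
  have i1': "i1 = k + r" and j1': "j1 = l + n" using k l by (auto simp: r_def n_def)
  have j2': "j2 = r + n" using s i1' j1' by simp
  have \<nu>: "?\<nu> \<noteq> 0" "?\<nu> = q powr (- real I)" using q by (auto simp: nu_def powi_eq_powr)
  let ?e1 = "q powr (real k * (real k - 1) / 2 - real (k + l) * real k)"
  let ?e2 = "q powr (real k * (real k - 1) / 2 - real i1 * real k)"
  let ?e4 = "(?\<nu> / \<alpha>) ^ k * q powr (real k * (real k + 1) / 2)"
  let ?e6 = "(- 1) ^ r * q powr (- (real j1 - real J) * real r - real r * (real r - 1) / 2)"
  note Q = qpoch_q_nonzero[OF q]
  have c1: "qpoch (q powi (- int (k + l))) q (int k) =
      (- 1) ^ k * ?e1 * qpoch q q (int (k + l)) / qpoch q q (int l)"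
    using qpoch_neg_power[OF q(1), of k l] Q[of l] by (simp add: powi_eq_powr q field_simps)
  have c2: "qpoch (q powi (- int i1)) q (int k) = (- 1) ^ k * ?e2 * qpoch q q (int i1) / qpoch q q (int r)"
    using qpoch_neg_power[OF q(1), of k r] Q[of r] unfolding i1' by (simp add: powi_eq_powr q field_simps)
  have c3: "qpoch (q powi (1 + int j2 - int i1) * q ^ k) q (int l) = qpoch q q (int j1) / qpoch q q (int n)"
  proof -
    have "q powi (1 + int j2 - int i1) * q ^ k = q * q ^ n"
      using q unfolding i1' j2' by (simp add: power_int_add power_int_diff power_add field_simps)
    then show ?thesis
      using qpoch_add[of q q n l] Q[of n] unfolding j1' by (simp add: add.commute field_simps)
  qed
  have c4: "qpoch (- \<alpha> * inverse ?\<nu>) q (int j2 - int i1) * qpoch (- q * ?\<nu> * inverse \<alpha>) q (int k) =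
     ?e4 * qpoch (- \<alpha> / (?\<nu> * q ^ k)) q (int n)"
  proof -
    \<comment> \<open>Only exponents \<open>I + t - k\<close> from \<open>0\<close> to
      \<open>I - 1\<close> occur here, and \<open>nz\<close> covers them.\<close>
    have "(- \<alpha> * inverse ?\<nu>) * q powr (real t - real k) \<noteq> 1" if "n \<le> t" "t < k" for t
    proof -
      have "inverse ?\<nu> * q powr (real t - real k) = q powr (real (I + t - k))"
        using that k i1 q
        by (simp add: \<nu>(2) powr_minus[symmetric] powr_add[symmetric] of_nat_diff algebra_simps)
      also have "\<dots> = q ^ (I + t - k)" using q by (simp add: powr_realpow)
      finally show ?thesis
        using nz[rule_format, of "I + t - k"] that k i1 kl by (auto simp: mult.assoc)
    qed
    moreover have "q / (- \<alpha> * inverse ?\<nu>) = - q * ?\<nu> * inverse \<alpha>"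
       "- 1 / (- \<alpha> * inverse ?\<nu>) = ?\<nu> / \<alpha>"
       "- \<alpha> * inverse ?\<nu> * q powr (- real k) = - \<alpha> / (?\<nu> * q ^ k)"
      using q \<alpha> \<nu>(1) by (auto simp: field_simps powr_minus powr_realpow)
    moreover have "int j2 - int i1 = int n - int k" using i1' j2' by simp
    ultimately show ?thesis
      using qpoch_int_diff_mult[of q "- \<alpha> * inverse ?\<nu>" n k] q \<alpha> \<nu>(1) by simp
  qed
  let ?B = "q powi (int J + 1 - int (k + l) - int j2) * q ^ k"
  have B: "?B = q powr (1 - (real j1 - real J) - real r)"
    using q unfolding i1' j1' j2'
    by (simp add: powi_eq_powr algebra_simps flip: powr_realpow powr_add)
  have c6: "qpoch ?B q (int r) = ?e6 * qpoch (q powr (real j1 - real J)) q (int r)"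
    unfolding B by (rule qpoch_reverse_power) (use q in auto)
  \<comment> \<open>Since \<open>j1 - j2 = l - r\<close>, the denominator shortens or extends the
    numerator from length \<open>l\<close> to length \<open>r\<close>. Its factors involve only
    positive powers of \<open>q\<close>, as \<open>j1\<close> and \<open>j2\<close> are at most
    \<open>J\<close>, so none of them vanishes.\<close>
  have c5: "qpoch ?B q (int l) / qpoch (q powi (int J + 1 - int j1)) q (int j1 - int j2) = qpoch ?B q (int r)
     \<and> qpoch (q powi (int J + 1 - int j1)) q (int j1 - int j2) \<noteq> 0"
  proof (cases "r \<le> l")
    case True
    have 1: "?B * q ^ r = q ^ (J + 1 - j1)"
      using q j1 unfolding B by (simp add: of_nat_diff algebra_simps flip: powr_realpow powr_add)
    have 2: "q powi (int J + 1 - int j1) = q ^ (J + 1 - j1)"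
      using j1 by (simp add: of_nat_diff algebra_simps flip: power_int_of_nat)
    have 3: "int j1 - int j2 = int (l - r)" using True j1' j2' by (simp add: of_nat_diff)
    have "qpoch (q ^ (J + 1 - j1)) q (int (l - r)) \<noteq> 0"
      by (rule qpoch_nonzero, subst power_add[symmetric], rule power_ne_1_real) (use q j1 in auto)
    then show ?thesis
      using qpoch_add[of ?B q r "l - r"] True unfolding 1 2 3 by simp
  next
    case False
    have 1: "?B * q ^ l * q ^ (r - l) = q powi (int J + 1 - int j1)"
      using q False unfolding B by (simp add: powi_eq_powr of_nat_diff algebra_simps flip: powr_realpow powr_add)
    have 3: "int j1 - int j2 = - int (r - l)" using False j1' j2' by (simp add: of_nat_diff)
    have 4: "q powi (int J + 1 - int j1) * q powi - int (r - l) = q ^ (J + 1 - j2)"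
      using q j2 False unfolding j1' j2'
      by (simp add: powi_eq_powr of_nat_diff algebra_simps flip: powr_realpow powr_add)
    have 5: "?B * q ^ l = q ^ (J + 1 - j2)"
      using q j2 unfolding B unfolding j1' j2' by (simp add: of_nat_diff algebra_simps flip: powr_realpow powr_add)
    have 6: "qpoch (q ^ (J + 1 - j2)) q (int (r - l)) \<noteq> 0"
      by (rule qpoch_nonzero, subst power_add[symmetric], rule power_ne_1_real) (use q j2 in auto)
    have "qpoch ?B q (int r) = qpoch ?B q (int l) * qpoch (q ^ (J + 1 - j2)) q (int (r - l))"
      using qpoch_add[of ?B q l "r - l"] False unfolding 5 by simp
    moreover have "qpoch (q powi (int J + 1 - int j1)) q (int j1 - int j2) =
        inverse (qpoch (q ^ (J + 1 - j2)) q (int (r - l)))"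
      unfolding 3 using qpoch_minus_of_nat[of q _ "r - l"] q 4 by simp
    ultimately show ?thesis using 6 by (simp add: divide_inverse)
  qed
  \<comment> \<open>Conservation makes the length \<open>i1 + j1\<close>; the cut at
    \<open>j1\<close> gives one normalization to each Vandermonde sum.\<close>
  have c7: "qpoch (- \<alpha>) q (int (k + l) + int j2) = qpoch (- \<alpha>) q (int j1) * qpoch (- \<alpha> * q ^ j1) q (int i1)"
    using qpoch_add[of "- \<alpha>" q j1 i1] s by (simp add: add.commute)
  have c7': "qpoch (- \<alpha>) q (int j1) \<noteq> 0" "qpoch (- \<alpha> * q ^ j1) q (int i1) \<noteq> 0"
    using nz i1 j1 by (auto intro!: qpoch_nonzero simp: mult.assoc simp flip: power_add)
  have sg: "(- 1 :: real) ^ k * (- 1) ^ k = 1" by (simp flip: power_add)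
  have kl': "int (k + l) - int k = int l" by simp
  show ?thesis
    unfolding kl' c1 c2 c3 c7 weight_term_def r_def[symmetric] n_def[symmetric]
    by (rule fraction_rearrange[OF c4 c5[THEN conjunct1, unfolded c6] sg Q])
      (use weight_power_identity[OF q(1) \<alpha> k l s, of I J] in \<open>simp only: r_def n_def mult_ac\<close>)
qed

lemma phi_bar_three:
  "phi_bar n [a1, a2, a3] [b1, b2, b3] q z =
    (\<Sum>k=0..n. z ^ k * (qpoch (q powi (- int n)) q (int k) / qpoch q q (int k)) *
       (qpoch a1 q (int k) * qpoch (b1 * q ^ k) q (int n - int k) *
       (qpoch a2 q (int k) * qpoch (b2 * q ^ k) q (int n - int k) *
       (qpoch a3 q (int k) * qpoch (b3 * q ^ k) q (int n - int k)))))"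
  by (simp add: phi_bar_def lessThan_Suc mult_ac)

text \<open>Termwise this is \<open>phi_bar_summand\<close> with \<open>l = m - k\<close>. The terms
  outside the rectangle vanish, so that as \<open>m\<close> varies the pairs \<open>(k, l)\<close>
  run through the antidiagonals of one fixed rectangle.\<close>

lemma vertex_weight_eq_sum_weight_term:
  fixes q \<alpha> :: real
  assumes q: "q > 0" "q \<noteq> 1" and \<alpha>: "\<alpha> \<noteq> 0"
    and nz: "\<forall>t<I + J. \<alpha> * q ^ t \<noteq> - 1"
    and ranges: "i1 \<le> I" "j1 \<le> J" "m \<le> I" "j2 \<le> J" and s: "i1 + j1 = m + j2"
  shows "vertex_weight I J q \<alpha> i1 j1 m j2 =
    (\<Sum>(k, l)\<in>{p \<in> {..i1} \<times> {..j1}. fst p + snd p = m}. weight_term I J q \<alpha> i1 j1 k l)"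
proof -
  define C where "C = q powr ((2 * real j1 - real j1 ^ 2) / 4 - (2 * real j2 - real j2 ^ 2) / 4
                + (real m ^ 2 + real i1 ^ 2) / 4
                + (real m * (real j2 - 1) + real i1 * real j1) / 2)
        * (nu I q powi (int j1 - int m) * \<alpha> powi (int j2 - int j1 + int m)
             * qpoch (- \<alpha> * inverse (nu I q)) q (int j2 - int i1)
           / (qpoch q q (int m) * qpoch (- \<alpha>) q (int m + int j2)
              * qpoch (q powi (int J + 1 - int j1)) q (int j1 - int j2)))"
  define t where "t k = q ^ k * (qpoch (q powi (- int m)) q (int k) / qpoch q q (int k))
           * (qpoch (q powi (- int i1)) q (int k) * qpoch (nu I q * q ^ k) q (int m - int k)
            * (qpoch (- \<alpha> * q ^ J) q (int k) * qpoch (q powi (1 + int j2 - int i1) * q ^ k) q (int m - int k)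
            * (qpoch (- q * nu I q * inverse \<alpha>) q (int k)
               * qpoch (q powi (int J + 1 - int m - int j2) * q ^ k) q (int m - int k))))" for k
  \<comment> \<open>A term with \<open>k > i1\<close> is killed by the upper parameter
    \<open>q powi (- int i1)\<close>, one with \<open>m - k > j1\<close> by the second lower
    parameter, whose symbol then contains \<open>1 - q powi 0\<close>.\<close>
  have t0: "t k = 0" if "k \<le> m" "\<not> (k \<le> i1 \<and> m - k \<le> j1)" for k
  proof (cases "k \<le> i1")
    case False
    have "qpoch (q powi (- int i1)) q (int k) = 0"
      by (rule qpoch_eq_0[of i1]) (use False q in \<open>auto simp: power_int_minus\<close>)
    then show ?thesis by (simp add: t_def)
  next
    case True
    with that have j1: "j1 < m - k" by simp
    have "q powi (1 + int j2 - int i1) * q ^ k * q ^ (m - k - j1 - 1) =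
        q powi (1 + int j2 - int i1 + int k + int (m - k - j1 - 1))"
      using q by (simp add: power_int_add)
    also have "1 + int j2 - int i1 + int k + int (m - k - j1 - 1) = 0"
      using j1 that s by simp
    finally have "qpoch (q powi (1 + int j2 - int i1) * q ^ k) q (int (m - k)) = 0"
      using j1 by (intro qpoch_eq_0[of "m - k - j1 - 1"]) auto
    then show ?thesis using that by (simp add: t_def of_nat_diff)
  qed
  have "vertex_weight I J q \<alpha> i1 j1 m j2 = C * (\<Sum>k=0..m. t k)"
    unfolding vertex_weight_def phi_bar_three C_def t_def using s by simp
  also have "(\<Sum>k=0..m. t k) = (\<Sum>k | k \<le> m \<and> k \<le> i1 \<and> m - k \<le> j1. t k)"
    by (rule sum.mono_neutral_right) (use t0 in auto)
  also have "C * \<dots> = (\<Sum>k | k \<le> m \<and> k \<le> i1 \<and> m - k \<le> j1. weight_term I J q \<alpha> i1 j1 k (m - k))"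
    unfolding sum_distrib_left
  proof (rule sum.cong)
    fix k assume "k \<in> {k. k \<le> m \<and> k \<le> i1 \<and> m - k \<le> j1}"
    then have k: "k \<le> i1" "m - k \<le> j1" and m: "m = k + (m - k)" by auto
    show "C * t k = weight_term I J q \<alpha> i1 j1 k (m - k)"
      using phi_bar_summand[OF q \<alpha> nz ranges(1,2,4) k] ranges(3) s
      unfolding m[symmetric] C_def t_def by simp
  qed simp
  also have "\<dots> = (\<Sum>(k, l)\<in>{p \<in> {..i1} \<times> {..j1}. fst p + snd p = m}. weight_term I J q \<alpha> i1 j1 k l)"
    by (rule sum.reindex_bij_witness[of _ fst "\<lambda>k. (k, m - k)"]) auto
  finally show ?thesis .
qed

section \<open>The mean of \<open>q\<close> to the power \<open>- i2\<close> under the vertex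
  weights\<close>

text \<open>An output out of range meets a zero factor: index \<open>I - k\<close> in the symbol
  based at \<open>nu I q * q ^ k\<close>, or index \<open>J - j1\<close> in the one based at
  \<open>q powr (real j1 - real J)\<close>. This permits summing over the whole rectangle.\<close>

lemma weight_term_eq_0:
  fixes q \<alpha> :: real
  assumes q: "q > 0" and "i1 \<le> I" "k \<le> i1" and "k + l > I \<or> i1 + j1 > k + l + J"
    and "j1 \<le> J"
  shows "weight_term I J q \<alpha> i1 j1 k l = 0"
  using assms(4)
proof
  assume *: "k + l > I"
  have "nu I q * q ^ k * q ^ (I - k) = 1"
    using q assms by (simp add: nu_def mult.assoc power_int_minus flip: power_add)
  then have "qpoch (nu I q * q ^ k) q (int l) = 0"
    using * assms by (intro qpoch_eq_0[of "I - k"]) auto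
  then show ?thesis by (simp add: weight_term_def)
next
  assume *: "i1 + j1 > k + l + J"
  have "q powr (real j1 - real J) * q ^ (J - j1) = 1"
    using q assms(5) by (simp add: of_nat_diff flip: powr_realpow powr_add)
  then have "qpoch (q powr (real j1 - real J)) q (int (i1 - k)) = 0"
    using * assms by (intro qpoch_eq_0[of "J - j1"]) auto
  then show ?thesis by (simp add: weight_term_def)
qed

text \<open>The sum over \<open>l\<close> is a Vandermonde moment with
  \<open>a = nu I q * q ^ k\<close> and \<open>a * b = - \<alpha>\<close>. Its value is affine in
  \<open>q ^ k\<close>, so the sum over \<open>k\<close> needs one more moment and one plain sum,
  with \<open>a = - \<alpha> * q ^ J\<close> and \<open>a * b = - \<alpha> * q ^ j1\<close>.\<close>

lemma sum_weight_term_moment: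
  fixes q \<alpha> :: real
  assumes q: "q > 0" "q \<noteq> 1" and \<alpha>: "\<alpha> \<noteq> 0"
    and nz: "\<forall>t<I + J. \<alpha> * q ^ t \<noteq> - 1" and "I \<ge> 1"
    and ranges: "i1 \<le> I" "j1 \<le> J"
  shows "(1 + \<alpha>) * (\<Sum>k\<le>i1. \<Sum>l\<le>j1. weight_term I J q \<alpha> i1 j1 k l / q ^ (k + l)) =
    (\<alpha> + nu I q) + (1 + \<alpha> * q ^ J) / q ^ (i1 + j1) - (nu I q + \<alpha> * q ^ J) / q ^ j1"
proof -
  let ?\<nu> = "nu I q"
  have \<nu>: "?\<nu> \<noteq> 0" using q by (simp add: nu_def)
  have \<alpha>1: "1 + \<alpha> \<noteq> 0" using nz[rule_format, of 0] \<open>I \<ge> 1\<close> by auto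
  note Q = qpoch_q_nonzero[OF q]
  define A where "A = - \<alpha> * q ^ J"
  define U where "U k = qpoch A q (int k) / qpoch q q (int k)
           * (qpoch (q powr (real j1 - real J)) q (int (i1 - k)) / qpoch q q (int (i1 - k)))" for k
  define V where "V k l = qpoch (?\<nu> * q ^ k) q (int l) / qpoch q q (int l)
           * (qpoch (- \<alpha> / (?\<nu> * q ^ k)) q (int (j1 - l)) / qpoch q q (int (j1 - l)))" for k l
  define ci where "ci = qpoch q q (int i1) / qpoch (- \<alpha> * q ^ j1) q (int i1)"
  define cj where "cj = qpoch q q (int j1) / qpoch (- \<alpha>) q (int j1)"
  have nz': "qpoch (- \<alpha>) q (int j1) \<noteq> 0" "qpoch (- \<alpha> * q ^ j1) q (int i1) \<noteq> 0"
    using nz ranges by (auto intro!: qpoch_nonzero simp: mult.assoc simp flip: power_add)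
  have wt: "weight_term I J q \<alpha> i1 j1 k l = ci * (U k * A ^ (i1 - k)) * (cj * (V k l * (?\<nu> * q ^ k) ^ (j1 - l)))" for k l
    unfolding weight_term_def U_def V_def A_def ci_def cj_def ..
  have j: "(1 + \<alpha>) * (\<Sum>l\<le>j1. cj * (V k l * (?\<nu> * q ^ k) ^ (j1 - l)) / q ^ l) =
      1 / q ^ j1 + \<alpha> - ?\<nu> * q ^ k / q ^ j1 * (1 - q ^ j1)" for k
  proof -
    have ab: "?\<nu> * q ^ k * (- \<alpha> / (?\<nu> * q ^ k)) = - \<alpha>" using q \<nu> by simp
    \<comment> \<open>Dividing by \<open>q ^ l\<close> amounts to multiplying by
      \<open>q ^ (j1 - l) / q ^ j1\<close>, the form of the moment lemma.\<close>
    have "(\<Sum>l\<le>j1. cj * (V k l * (?\<nu> * q ^ k) ^ (j1 - l)) / q ^ l) =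
        cj / q ^ j1 * (\<Sum>l\<le>j1. V k l * (?\<nu> * q ^ k * q) ^ (j1 - l))"
      unfolding sum_distrib_left
    proof (rule sum.cong)
      fix l assume "l \<in> {..j1}"
      then have "q ^ j1 = q ^ l * q ^ (j1 - l)" by (simp flip: power_add)
      then show "cj * (V k l * (?\<nu> * q ^ k) ^ (j1 - l)) / q ^ l = cj / q ^ j1 * (V k l * (?\<nu> * q ^ k * q) ^ (j1 - l))"
        using q by (simp add: power_mult_distrib)
    qed simp
    then have "(1 + \<alpha>) * (\<Sum>l\<le>j1. cj * (V k l * (?\<nu> * q ^ k) ^ (j1 - l)) / q ^ l) =
        cj / q ^ j1 * ((1 - (- \<alpha>)) * (\<Sum>l\<le>j1. V k l * (?\<nu> * q ^ k * q) ^ (j1 - l)))"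
      by simp
    also have "(1 - (- \<alpha>)) * (\<Sum>l\<le>j1. V k l * (?\<nu> * q ^ k * q) ^ (j1 - l)) =
        1 / cj * (1 - (- \<alpha>) * q ^ j1 - ?\<nu> * q ^ k + ?\<nu> * q ^ k * q ^ j1)"
      using q_chu_vandermonde_moment[OF q, of "?\<nu> * q ^ k" "- \<alpha> / (?\<nu> * q ^ k)" j1]
      unfolding V_def[symmetric] ab cj_def by simp
    also have "cj / q ^ j1 * \<dots> = 1 / q ^ j1 + \<alpha> - ?\<nu> * q ^ k / q ^ j1 * (1 - q ^ j1)"
      using Q[of j1] nz' q by (simp add: cj_def field_simps)
    finally show ?thesis .
  qed
  have ab: "A * q powr (real j1 - real J) = - \<alpha> * q ^ j1"
    using q by (simp add: A_def mult.assoc flip: powr_realpow powr_add)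
  have i0: "(\<Sum>k\<le>i1. ci * (U k * A ^ (i1 - k))) = 1"
  proof -
    show ?thesis
      using q_chu_vandermonde[OF q, of A "q powr (real j1 - real J)" i1] Q[of i1] nz'
      unfolding U_def[symmetric] ci_def sum_distrib_left[symmetric] ab by simp
  qed
  have i1: "(1 + \<alpha> * q ^ j1) * (\<Sum>k\<le>i1. ci * (U k * A ^ (i1 - k)) / q ^ k) =
      (1 + \<alpha> * q ^ j1 * q ^ i1 - A * (1 - q ^ i1)) / q ^ i1"
  proof -
    have "(\<Sum>k\<le>i1. ci * (U k * A ^ (i1 - k)) / q ^ k) =
        ci / q ^ i1 * (\<Sum>k\<le>i1. U k * (A * q) ^ (i1 - k))"
      unfolding sum_distrib_left
    proof (rule sum.cong)
      fix l assume "l \<in> {..i1}"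
      then have "q ^ i1 = q ^ l * q ^ (i1 - l)" by (simp flip: power_add)
      then show "ci * (U l * A ^ (i1 - l)) / q ^ l = ci / q ^ i1 * (U l * (A * q) ^ (i1 - l))"
        using q by (simp add: power_mult_distrib)
    qed simp
    then have "(1 + \<alpha> * q ^ j1) * (\<Sum>k\<le>i1. ci * (U k * A ^ (i1 - k)) / q ^ k) =
        ci / q ^ i1 * ((1 - (- \<alpha> * q ^ j1)) * (\<Sum>k\<le>i1. U k * (A * q) ^ (i1 - k)))"
      by simp
    also have "(1 - (- \<alpha> * q ^ j1)) * (\<Sum>k\<le>i1. U k * (A * q) ^ (i1 - k)) =
        1 / ci * (1 - (- \<alpha> * q ^ j1) * q ^ i1 - A + A * q ^ i1)"
      using q_chu_vandermonde_moment[OF q, of A "q powr (real j1 - real J)" i1]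
      unfolding U_def[symmetric] ci_def ab by simp
    also have "ci / q ^ i1 * \<dots> = (1 + \<alpha> * q ^ j1 * q ^ i1 - A * (1 - q ^ i1)) / q ^ i1"
      using Q[of i1] nz' q by (simp add: ci_def field_simps)
    finally show ?thesis .
  qed
  have "(1 + \<alpha>) * (\<Sum>k\<le>i1. \<Sum>l\<le>j1. weight_term I J q \<alpha> i1 j1 k l / q ^ (k + l)) =
     (\<Sum>k\<le>i1. ci * (U k * A ^ (i1 - k)) / q ^ k *
        ((1 + \<alpha>) * (\<Sum>l\<le>j1. cj * (V k l * (?\<nu> * q ^ k) ^ (j1 - l)) / q ^ l)))"
    unfolding wt sum_distrib_left by (simp add: power_add mult_ac)
  \<comment> \<open>The constant part \<open>1 / q ^ j1 + \<alpha>\<close> is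
    \<open>(1 + \<alpha> * q ^ j1) / q ^ j1\<close>; its numerator is just the factor
    \<open>1 - a * b\<close> that the moment in \<open>k\<close> carries.\<close>
  also have "\<dots> = (\<Sum>k\<le>i1. (1 + \<alpha> * q ^ j1) / q ^ j1 * (ci * (U k * A ^ (i1 - k)) / q ^ k)
       - ?\<nu> / q ^ j1 * (1 - q ^ j1) * (ci * (U k * A ^ (i1 - k))))"
    unfolding j using q by (intro sum.cong) (simp_all add: field_simps)
  also have "\<dots> = ((1 + \<alpha> * q ^ j1) * (\<Sum>k\<le>i1. ci * (U k * A ^ (i1 - k)) / q ^ k)) / q ^ j1
      - ?\<nu> / q ^ j1 * (1 - q ^ j1)"
    unfolding sum_subtractf sum_distrib_left[symmetric] i0[unfolded sum_distrib_left[symmetric]]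
    by simp
  also have "\<dots> = (\<alpha> + ?\<nu>) + (1 + \<alpha> * q ^ J) / q ^ (i1 + j1) - (?\<nu> + \<alpha> * q ^ J) / q ^ j1"
    unfolding i1 unfolding A_def using q by (simp add: field_simps power_add)
  finally show ?thesis .
qed

text \<open>Grouping the rectangle along \<open>k + l = m\<close> recovers the output
  \<open>i2 = m\<close>, whose partner \<open>j2\<close> is forced by conservation.\<close>

lemma vertex_weight_moment:
  fixes q \<alpha> :: real
  assumes q: "q > 0" "q \<noteq> 1" and \<alpha>: "\<alpha> \<noteq> 0"
    and nz: "\<forall>t<I + J. \<alpha> * q ^ t \<noteq> - 1" and "I \<ge> 1"
    and ranges: "i1 \<le> I" "j1 \<le> J"
  shows "(\<Sum>i2\<le>I. \<Sum>j2\<le>J. vertex_weight I J q \<alpha> i1 j1 i2 j2 / q ^ i2) =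
    ((\<alpha> + nu I q) + (1 + \<alpha> * q ^ J) / q ^ (i1 + j1) - (nu I q + \<alpha> * q ^ J) / q ^ j1) / (1 + \<alpha>)"
proof -
  let ?w = "\<lambda>p. weight_term I J q \<alpha> i1 j1 (fst p) (snd p) / q ^ (fst p + snd p)"
  let ?P = "{..i1} \<times> {..j1}"
  define g where "g m = (\<Sum>p\<in>{p \<in> ?P. fst p + snd p = m}. ?w p)" for m
  have "(\<Sum>j2\<le>J. vertex_weight I J q \<alpha> i1 j1 m j2 / q ^ m) = g m" if m: "m \<le> I" for m
  proof (cases "m \<le> i1 + j1 \<and> i1 + j1 - m \<le> J")
    case True
    have "(\<Sum>j2\<le>J. vertex_weight I J q \<alpha> i1 j1 m j2 / q ^ m) =
        (\<Sum>j2\<le>J. if j2 = i1 + j1 - m then vertex_weight I J q \<alpha> i1 j1 m (i1 + j1 - m) / q ^ m else 0)"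
      using True by (intro sum.cong) (auto simp: vertex_weight_def)
    also have "\<dots> = vertex_weight I J q \<alpha> i1 j1 m (i1 + j1 - m) / q ^ m"
      using True by simp
    also have "\<dots> = g m"
      using vertex_weight_eq_sum_weight_term[OF q \<alpha> nz ranges m, of "i1 + j1 - m"] True
      by (simp add: g_def sum_divide_distrib case_prod_unfold)
    finally show ?thesis .
  next
    case False
    have "vertex_weight I J q \<alpha> i1 j1 m j2 = 0" if "j2 \<le> J" for j2
      using False that by (auto simp: vertex_weight_def)
    \<comment> \<open>Either no pair of the rectangle has \<open>k + l = m\<close>, or the forced
      \<open>j2\<close> exceeds \<open>J\<close> and every term vanishes.\<close>
    moreover have "g m = 0"
      unfolding g_def using False m
      by (intro sum.neutral) (auto intro!: weight_term_eq_0 q ranges)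
    ultimately show ?thesis by simp
  qed
  then have "(\<Sum>i2\<le>I. \<Sum>j2\<le>J. vertex_weight I J q \<alpha> i1 j1 i2 j2 / q ^ i2) = (\<Sum>m\<le>I. g m)"
    by simp
  \<comment> \<open>Values of \<open>m\<close> above \<open>I\<close> contribute only vanishing
    terms; including them makes the antidiagonals cover the rectangle.\<close>
  also have "\<dots> = (\<Sum>m\<le>I + (i1 + j1). g m)"
  proof (rule sum.mono_neutral_left)
    show "\<forall>m\<in>{..I + (i1 + j1)} - {..I}. g m = 0"
      unfolding g_def by (intro ballI sum.neutral) (auto intro!: weight_term_eq_0 q ranges)
  qed auto
  also have "\<dots> = (\<Sum>p\<in>?P. ?w p)"
    unfolding g_def by (rule sum.group) auto
  also have "\<dots> = (\<Sum>k\<le>i1. \<Sum>l\<le>j1. weight_term I J q \<alpha> i1 j1 k l / q ^ (k + l))"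
    by (simp add: sum.cartesian_product case_prod_unfold)
  finally show ?thesis
    using sum_weight_term_moment[OF q \<alpha> nz \<open>I \<ge> 1\<close> ranges] nz[rule_format, of 0] \<open>I \<ge> 1\<close>
    by (simp add: field_simps)
qed

subsection \<open>Conditioning on sampled vertices\<close>

lemma space_generated_by [simp]: "space (generated_by M S) = space M"
  unfolding generated_by_def by (rule space_measure_of) auto

lemma sets_generated_by:
  "sets (generated_by M S) = sigma_sets (space M) {X -` A \<inter> space M | X A. X \<in> S}"
  unfolding generated_by_def by (rule sets_measure_of) auto

lemma measurable_generated_by:
  "X \<in> S \<Longrightarrow> X \<in> measurable (generated_by M S) (count_space UNIV)"
  by (rule measurableI) (auto simp: sets_generated_by)

lemma sets_generated_by_subset:
  assumes "\<And>X. X \<in> S \<Longrightarrow> X \<in> measurable N (count_space UNIV)" "space N = space M"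
  shows "sets (generated_by M S) \<subseteq> sets N"
proof -
  have "{X -` A \<inter> space M | X A. X \<in> S} \<subseteq> sets N"
    using assms(1)[THEN measurable_sets] assms(2) by auto
  then show ?thesis
    unfolding sets_generated_by using assms(2) sets.sigma_sets_subset[of _ N] by simp
qed

lemma measurable_nat_valued:
  assumes "f \<in> measurable M (count_space {0..n::nat})"
  shows "f \<in> measurable M (count_space UNIV)"
  using assms measurable_compose[OF assms, of id "count_space UNIV"] by simp

text \<open>The sets over which a signed integrable \<open>f\<close> integrates to zero form a
  Dynkin system as soon as the total integral is zero.\<close>

lemma (in finite_measure) zero_integral_sigma_sets:
  fixes f :: "'a \<Rightarrow> real"
  assumes f: "integrable M f" and E: "Int_stable E" "E \<subseteq> sets M"
    and zero: "\<And>A. A \<in> E \<Longrightarrow> set_lebesgue_integral M A f = 0" "(\<integral>x. f x \<partial>M) = 0"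
    and A: "A \<in> sigma_sets (space M) E"
  shows "set_lebesgue_integral M A f = 0"
proof -
  have sub: "sigma_sets (space M) E \<subseteq> sets M"
    using E(2) by (rule sets.sigma_sets_subset)
  have ind: "set_integrable M B f" if "B \<in> sets M" for B
    unfolding set_integrable_def using that f by (intro integrable_mult_indicator) auto
  have "E \<subseteq> Pow (space M)" using E(2) sets.sets_into_space by auto
  from E(1) this A show ?thesis
  proof (induction rule: sigma_sets_induct_disjoint)
    case (basic A)
    then show ?case by (rule zero)
  next
    case empty
    show ?case by (simp add: set_lebesgue_integral_def)
  next
    case (compl A)
    then have A: "A \<in> sets M" using sub by auto
    have "set_lebesgue_integral M (space M) f = set_lebesgue_integral M (A \<union> (space M - A)) f"
      using sets.sets_into_space[OF A] by (intro arg_cong[of _ _ "\<lambda>B. set_lebesgue_integral M B f"]) auto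
    also have "\<dots> = set_lebesgue_integral M A f + set_lebesgue_integral M (space M - A) f"
      by (rule set_integral_Un) (use A in \<open>auto intro!: ind\<close>)
    finally show ?case using compl zero(2) set_integral_space[OF f] by simp
  next
    case (union A)
    then have A: "A i \<in> sets M" for i using sub by blast
    have "set_lebesgue_integral M (\<Union>i. A i) f = (\<Sum>i. set_lebesgue_integral M (A i) f)"
      by (rule lebesgue_integral_countable_add)
        (use union A in \<open>auto simp: disjoint_family_on_def intro!: ind sets.countable_UN\<close>)
    then show ?case using union by simp
  qed
qed

lemma measurable_compose_nat2:
  fixes X Y :: "'a \<Rightarrow> nat"
  assumes X: "X \<in> measurable M (count_space UNIV)" and Y: "Y \<in> measurable M (count_space UNIV)"
    and F: "\<And>i j. F i j \<in> space N"
  shows "(\<lambda>\<omega>. F (X \<omega>) (Y \<omega>)) \<in> measurable M N"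
proof (rule measurable_compose_countable[OF _ X])
  show "(\<lambda>\<omega>. F i (Y \<omega>)) \<in> measurable M N" for i
    by (rule measurable_compose[OF Y]) (simp add: F)
qed

lemma sum_of_bool_pair:
  fixes F :: "nat \<Rightarrow> nat \<Rightarrow> real"
  assumes "a \<le> m" "b \<le> n"
  shows "F a b = (\<Sum>i\<le>m. \<Sum>j\<le>n. F i j * of_bool (a = i \<and> b = j))"
proof -
  have "(\<Sum>j\<le>n. F i j * of_bool (a = i \<and> b = j)) = (if a = i then F i b else 0)" for i
    using assms by (auto simp: of_bool_def if_distrib cong: if_cong)
  then show ?thesis using assms by simp
qed

text \<open>As \<open>X\<close> and \<open>Y\<close> take finitely many values,
  \<open>F (X \<omega>) (Y \<omega>)\<close> is a finite combination of indicators, so the vertex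
  weights can serve as \<open>F\<close> without a bound on them.\<close>

lemma integrable_mult_bounded_nat2:
  fixes F :: "nat \<Rightarrow> nat \<Rightarrow> real"
  assumes f: "integrable M f" and X [measurable]: "X \<in> measurable M (count_space UNIV)"
    and Y [measurable]: "Y \<in> measurable M (count_space UNIV)"
    and bounds: "\<And>\<omega>. \<omega> \<in> space M \<Longrightarrow> X \<omega> \<le> m" "\<And>\<omega>. \<omega> \<in> space M \<Longrightarrow> Y \<omega> \<le> n"
  shows "integrable M (\<lambda>\<omega>. f \<omega> * F (X \<omega>) (Y \<omega>))"
proof -
  have "integrable M (\<lambda>\<omega>. \<Sum>i\<le>m. \<Sum>j\<le>n. F i j * (f \<omega> * indicator {\<omega> \<in> space M. X \<omega> = i \<and> Y \<omega> = j} \<omega>))"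
    by (intro Bochner_Integration.integrable_sum integrable_mult_right integrable_real_mult_indicator f) measurable
  also have "?this \<longleftrightarrow> ?thesis"
  proof (rule Bochner_Integration.integrable_cong)
    fix \<omega> assume \<omega>: "\<omega> \<in> space M"
    then show "(\<Sum>i\<le>m. \<Sum>j\<le>n. F i j * (f \<omega> * indicator {\<omega> \<in> space M. X \<omega> = i \<and> Y \<omega> = j} \<omega>)) = f \<omega> * F (X \<omega>) (Y \<omega>)"
      unfolding sum_of_bool_pair[OF bounds[OF \<omega>], of F] sum_distrib_left
      by (intro sum.cong refl) (simp add: indicator_def)
  qed simp
  finally show ?thesis .
qed

lemma zero_integral_mult_nat2:
  fixes F :: "nat \<Rightarrow> nat \<Rightarrow> real"
  assumes f: "integrable M f" and XY: "X \<in> measurable M (count_space UNIV)" "Y \<in> measurable M (count_space UNIV)"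
    and bounds: "\<And>\<omega>. \<omega> \<in> space M \<Longrightarrow> X \<omega> \<le> m" "\<And>\<omega>. \<omega> \<in> space M \<Longrightarrow> Y \<omega> \<le> n"
    and zero: "\<And>i j. i \<le> m \<Longrightarrow> j \<le> n \<Longrightarrow> (\<integral>\<omega>. f \<omega> * of_bool (X \<omega> = i \<and> Y \<omega> = j) \<partial>M) = 0"
  shows "(\<integral>\<omega>. f \<omega> * F (X \<omega>) (Y \<omega>) \<partial>M) = 0"
proof -
  have ind: "integrable M (\<lambda>\<omega>. f \<omega> * of_bool (X \<omega> = i \<and> Y \<omega> = j))" for i j
    by (rule integrable_mult_bounded_nat2[OF f XY bounds])
  have "(\<integral>\<omega>. f \<omega> * F (X \<omega>) (Y \<omega>) \<partial>M) =
      (\<integral>\<omega>. (\<Sum>i\<le>m. \<Sum>j\<le>n. F i j * (f \<omega> * of_bool (X \<omega> = i \<and> Y \<omega> = j))) \<partial>M)"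
  proof (rule Bochner_Integration.integral_cong)
    fix \<omega> assume \<omega>: "\<omega> \<in> space M"
    then show "f \<omega> * F (X \<omega>) (Y \<omega>) = (\<Sum>i\<le>m. \<Sum>j\<le>n. F i j * (f \<omega> * of_bool (X \<omega> = i \<and> Y \<omega> = j)))"
      unfolding sum_of_bool_pair[OF bounds[OF \<omega>], of F] sum_distrib_left
      by (intro sum.cong refl) simp
  qed simp
  also have "\<dots> = 0"
    using ind zero by (simp add: Bochner_Integration.integral_sum)
  finally show ?thesis .
qed

section \<open>The \<sigma>-algebras of observed vertices\<close>

text \<open>Indexing by vertices instead of lines lets the \<sigma>-algebras grow by one vertex,
  with both of its outputs, at a time.\<close>

abbreviation known_variables ::
    "(nat \<Rightarrow> nat \<Rightarrow> 'a \<Rightarrow> nat) \<Rightarrow> (nat \<Rightarrow> nat \<Rightarrow> 'a \<Rightarrow> nat) \<Rightarrow> (nat \<times> nat) set \<Rightarrow> ('a \<Rightarrow> nat) set" where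
  "known_variables v h S \<equiv> {v i 0 | i. True} \<union> {h 0 j | j. True}
      \<union> {v i (j + 1) | i j. (i, j) \<in> S} \<union> {h (i + 1) j | i j. (i, j) \<in> S}"

definition earlier :: "nat \<Rightarrow> nat \<Rightarrow> (nat \<times> nat) set" where
  "earlier x y = {(i, j). i + j \<le> x + y \<and> (i, j) \<noteq> (x, y)}"

text \<open>Every height that generates \<open>filt\<close> can be computed from the boundary data
  and the outputs of these vertices; \<open>(x, y)\<close> is not one of them.\<close>

definition past :: "nat \<Rightarrow> nat \<Rightarrow> (nat \<times> nat) set" where
  "past x y = {(a, b). a < x \<or> b < y}"

lemma known_variables_mono: "S \<subseteq> T \<Longrightarrow> known_variables v h S \<subseteq> known_variables v h T"
  by blast

text \<open>Each variable involves at most one vertex, and hence is already present on finitely many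
  diagonals.\<close>

lemma known_variables_single:
  assumes "X \<in> known_variables v h S"
  obtains i j where "X \<in> known_variables v h (S \<inter> {(i, j)})"
  using assms by blast

context shs6v
begin

definition known :: "(nat \<times> nat) set \<Rightarrow> 'a measure" where
  "known S = generated_by M (known_variables v h S)"

lemma v_measurable [measurable]: "v x y \<in> measurable M (count_space UNIV)"
  using v_range by (rule measurable_nat_valued)

lemma h_measurable [measurable]: "h x y \<in> measurable M (count_space UNIV)"
  using h_range by (rule measurable_nat_valued)

lemma v_le: "\<omega> \<in> space M \<Longrightarrow> v x y \<omega> \<le> I"
  using measurable_space[OF v_range, of \<omega> x y] by simp

lemma h_le: "\<omega> \<in> space M \<Longrightarrow> h x y \<omega> \<le> J"
  using measurable_space[OF h_range, of \<omega> x y] by simp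

lemma space_known [simp]: "space (known S) = space M"
  by (simp add: known_def)

lemma sampled_before_eq_known:
  "sampled_before M v h x y = known {(i, j). i + j \<le> x + y \<and> (i, j) \<noteq> (x, y)}"
  unfolding sampled_before_def known_def by (rule arg_cong[of _ _ "generated_by M"]) auto

lemma sets_known_subset: "sets (known S) \<subseteq> sets M"
  unfolding known_def by (rule sets_generated_by_subset) auto

lemma sets_known_mono: "S \<subseteq> T \<Longrightarrow> sets (known S) \<subseteq> sets (known T)"
  unfolding known_def by (rule sets_generated_by_subset) (auto intro!: measurable_generated_by)

lemma v_known: "(y > 0 \<Longrightarrow> (x, y - 1) \<in> S) \<Longrightarrow> v x y \<in> measurable (known S) (count_space UNIV)"
  unfolding known_def by (rule measurable_generated_by) (cases y; fastforce)

lemma h_known: "(x > 0 \<Longrightarrow> (x - 1, y) \<in> S) \<Longrightarrow> h x y \<in> measurable (known S) (count_space UNIV)"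
  unfolding known_def by (rule measurable_generated_by) (cases x; fastforce)

lemma height_known:
  assumes "\<And>i. i < x \<Longrightarrow> y > 0 \<Longrightarrow> (i, y - 1) \<in> S"
  shows "height v h x y \<in> measurable (known S) (count_space UNIV)"
proof -
  have [measurable]: "h 0 j \<in> measurable (known S) (count_space UNIV)" for j
    by (rule h_known) simp
  have 1: "(\<lambda>\<omega>. \<Sum>j=1..n. int (h 0 (j - 1) \<omega>)) \<in> measurable (known S) (count_space UNIV)" for n
    by (induction n) simp_all
  have 2: "(\<lambda>\<omega>. \<Sum>i=1..n. int (v (i - 1) y \<omega>)) \<in> measurable (known S) (count_space UNIV)" if "n \<le> x" for n
    using that
  proof (induction n)
    case (Suc n)
    have [measurable]: "v n y \<in> measurable (known S) (count_space UNIV)"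
      using assms Suc.prems by (intro v_known) auto
    show ?case using Suc by simp
  qed simp
  show ?thesis
    unfolding height_def[abs_def] using 1[of y] 2[of x] by measurable
qed

lemma subalgebra_known: "subalgebra M (known S)"
  using sets_known_subset by (simp add: subalgebra_def)

lemma known_sigma_finite: "sigma_finite_subalgebra M (known S)"
  by (intro finite_measure_subalgebra_is_sigma_finite finite_measure_subalgebra.intro
    finite_measure_subalgebra_axioms.intro subalgebra_known finite_measure_axioms)


lemma inputs_known_earlier [measurable]:
  "v x y \<in> measurable (known (earlier x y)) (count_space UNIV)"
  "h x y \<in> measurable (known (earlier x y)) (count_space UNIV)"
  by (auto intro!: v_known h_known simp: earlier_def)

section \<open>The sampling rule and conservation of lines\<close>

text \<open>The form in which \<open>sampling\<close> is used throughout: by the defining property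
  of conditional expectation, the output indicator may be exchanged for the vertex weight under the
  integral.\<close>

lemma integral_output_indicator:
  assumes f: "f \<in> borel_measurable (known (earlier x y))" "integrable M f"
    and ranges: "i2 \<le> I" "j2 \<le> J"
  shows "(\<integral>\<omega>. f \<omega> * of_bool (v x (y + 1) \<omega> = i2 \<and> h (x + 1) y \<omega> = j2) \<partial>M) =
    (\<integral>\<omega>. f \<omega> * vertex_weight I J q \<alpha> (v x y \<omega>) (h x y \<omega>) i2 j2 \<partial>M)"
proof -
  interpret F: sigma_finite_subalgebra M "known (earlier x y)" by (rule known_sigma_finite)
  define B where "B = {\<omega> \<in> space M. v x (y + 1) \<omega> = i2 \<and> h (x + 1) y \<omega> = j2}"
  have B [measurable]: "B \<in> sets M" unfolding B_def by measurable
  have fM [measurable]: "f \<in> borel_measurable M" using f(2) by (rule borel_measurable_integrable)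
  have [measurable]: "(\<lambda>\<omega>. vertex_weight I J q \<alpha> (v x y \<omega>) (h x y \<omega>) i2 j2) \<in> borel_measurable M"
    by (rule measurable_compose_nat2) auto
  have "(\<integral>\<omega>. f \<omega> * of_bool (v x (y + 1) \<omega> = i2 \<and> h (x + 1) y \<omega> = j2) \<partial>M) = (\<integral>\<omega>. f \<omega> * indicator B \<omega> \<partial>M)"
    by (rule Bochner_Integration.integral_cong) (auto simp: B_def)
  also have "\<dots> = (\<integral>\<omega>. f \<omega> * real_cond_exp M (known (earlier x y)) (indicator B) \<omega> \<partial>M)"
    by (rule F.real_cond_exp_intg(2)[symmetric]) (use f B in \<open>auto intro: integrable_real_mult_indicator\<close>)
  also have "\<dots> = (\<integral>\<omega>. f \<omega> * vertex_weight I J q \<alpha> (v x y \<omega>) (h x y \<omega>) i2 j2 \<partial>M)"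
  proof (rule integral_cong_AE)
    show "AE \<omega> in M. f \<omega> * real_cond_exp M (known (earlier x y)) (indicator B) \<omega> =
        f \<omega> * vertex_weight I J q \<alpha> (v x y \<omega>) (h x y \<omega>) i2 j2"
      using sampling[OF ranges, of x y] unfolding sampled_before_eq_known B_def earlier_def by auto
  qed measurable
  finally show ?thesis .
qed

text \<open>Conservation is not postulated separately: the weights vanish unless
  \<open>i1 + j1 = i2 + j2\<close>, so for each of the finitely many outputs a violation has
  probability zero.\<close>

lemma lines_conserved: "AE \<omega> in M. v x y \<omega> + h x y \<omega> = v x (y + 1) \<omega> + h (x + 1) y \<omega>"
proof -
  have "AE \<omega> in M. \<not> (v x y \<omega> + h x y \<omega> \<noteq> i2 + j2 \<and> v x (y + 1) \<omega> = i2 \<and> h (x + 1) y \<omega> = j2)"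
    if ranges: "i2 \<le> I" "j2 \<le> J" for i2 j2
  proof -
    define f :: "'a \<Rightarrow> real" where "f \<omega> = of_bool (v x y \<omega> + h x y \<omega> \<noteq> i2 + j2)" for \<omega>
    define B where "B = {\<omega> \<in> space M. v x y \<omega> + h x y \<omega> \<noteq> i2 + j2 \<and> v x (y + 1) \<omega> = i2 \<and> h (x + 1) y \<omega> = j2}"
    have B [measurable]: "B \<in> sets M" unfolding B_def by measurable
    have f: "f \<in> borel_measurable (known (earlier x y))"
      unfolding f_def[abs_def] by (rule measurable_compose_nat2) auto
    have "integrable M f"
      by (rule integrable_const_bound[of _ 1])
        (use f measurable_from_subalg[OF subalgebra_known] in \<open>auto simp: f_def\<close>)
    have "prob B = (\<integral>\<omega>. indicator B \<omega> \<partial>M)" using B by simp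
    also have "\<dots> = (\<integral>\<omega>. f \<omega> * of_bool (v x (y + 1) \<omega> = i2 \<and> h (x + 1) y \<omega> = j2) \<partial>M)"
      by (rule Bochner_Integration.integral_cong) (auto simp: B_def f_def)
    also have "\<dots> = (\<integral>\<omega>. f \<omega> * vertex_weight I J q \<alpha> (v x y \<omega>) (h x y \<omega>) i2 j2 \<partial>M)"
      using f \<open>integrable M f\<close> ranges by (rule integral_output_indicator)
    also have "\<dots> = (\<integral>\<omega>. 0 \<partial>M)"
      by (rule Bochner_Integration.integral_cong) (auto simp: f_def vertex_weight_def)
    finally have "prob B = 0" by simp
    then have "AE \<omega> in M. \<omega> \<notin> B" using prob_eq_0[OF B] by simp
    then show ?thesis using AE_space by eventually_elim (auto simp: B_def)
  qed
  then have "AE \<omega> in M. \<forall>i2\<in>{..I}. \<forall>j2\<in>{..J}.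
      \<not> (v x y \<omega> + h x y \<omega> \<noteq> i2 + j2 \<and> v x (y + 1) \<omega> = i2 \<and> h (x + 1) y \<omega> = j2)"
    by (intro AE_finite_allI) auto
  then show ?thesis
    using AE_space by eventually_elim (use v_le h_le in blast)
qed

section \<open>The height function and \<open>xi\<close>\<close>

lemma height_Suc_left: "height v h (Suc x) y \<omega> = height v h x y \<omega> - int (v x y \<omega>)"
  by (simp add: height_def)

text \<open>The definition gives vertical increments only at \<open>x = 0\<close>. Further right
  they follow by applying conservation at the vertices \<open>(0, y)\<close> to
  \<open>(x - 1, y)\<close>, hence only almost surely.\<close>

lemma height_Suc_right: "AE \<omega> in M. height v h x (Suc y) \<omega> = height v h x y \<omega> + int (h x y \<omega>)"
proof (induction x)
  case 0
  show ?case by (simp add: height_def)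
next
  case (Suc x)
  then show ?case
    using lines_conserved[of x y] by eventually_elim (simp add: height_Suc_left)
qed

lemma height_bounds:
  assumes "\<omega> \<in> space M"
  shows "height v h x y \<omega> \<in> {- int (x * I)..int (y * J)}"
proof -
  have "(\<Sum>j=1..y. int (h 0 (j - 1) \<omega>)) \<le> (\<Sum>j=1..y. int J)"
    using h_le[OF assms] by (intro sum_mono) simp
  moreover have "(\<Sum>i=1..x. int (v (i - 1) y \<omega>)) \<le> (\<Sum>i=1..x. int I)"
    using v_le[OF assms] by (intro sum_mono) simp
  moreover have "(\<Sum>j=1..y. int (h 0 (j - 1) \<omega>)) \<ge> 0" "(\<Sum>i=1..x. int (v (i - 1) y \<omega>)) \<ge> 0"
    by (auto intro: sum_nonneg)
  ultimately show ?thesis by (simp add: height_def)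
qed

lemma height_measurable [measurable]: "height v h x y \<in> measurable M (count_space UNIV)"
  using height_known[of x y UNIV] measurable_from_subalg[OF subalgebra_known] by blast

lemma integrable_power_height:
  assumes "q > 0"
  shows "integrable M (\<lambda>\<omega>. q powi height v h x y \<omega>)"
proof (rule integrable_const_bound)
  \<comment> \<open>The height has finitely many values; the sum of all their powers is a bound for
    \<open>q < 1\<close> and \<open>q > 1\<close> alike.\<close>
  show "AE \<omega> in M. norm (q powi height v h x y \<omega>) \<le> (\<Sum>n\<in>{- int (x * I)..int (y * J)}. q powi n)"
    using AE_space
  proof eventually_elim
    case (elim \<omega>)
    then have "q powi height v h x y \<omega> \<le> (\<Sum>n\<in>{- int (x * I)..int (y * J)}. q powi n)"
      using assms by (intro member_le_sum height_bounds) auto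
    then show ?case using assms by simp
  qed
qed measurable

text \<open>All heights are expressed through \<open>height v h x (y + 1)\<close>, which is known
  before \<open>(x, y)\<close> is sampled. The output of \<open>(x, y)\<close> then enters only in
  the first term, and the subtracted quotient is the mean from
  \<open>vertex_weight_moment\<close>.\<close>

lemma xi_eq:
  assumes "q > 0"
  shows "AE \<omega> in M. xi I J q \<alpha> (height v h) (x + 1) (y + 1) \<omega> =
    q powi height v h x (y + 1) \<omega> / q ^ v x (y + 1) \<omega>
    - q powi height v h x (y + 1) \<omega> * (((\<alpha> + nu I q) + (1 + \<alpha> * q ^ J) / q ^ (v x y \<omega> + h x y \<omega>)
        - (nu I q + \<alpha> * q ^ J) / q ^ h x y \<omega>) / (1 + \<alpha>))"
  using height_Suc_right[of x y]
proof eventually_elim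
  case (elim \<omega>)
  have 1: "q powi height v h (Suc x) (Suc y) \<omega> = q powi height v h x (Suc y) \<omega> / q ^ v x (Suc y) \<omega>"
    using assms by (simp add: height_Suc_left power_int_diff)
  have 2: "q powi height v h x y \<omega> = q powi height v h x (Suc y) \<omega> / q ^ h x y \<omega>"
    using assms elim by (simp add: power_int_add)
  have 3: "q powi height v h (Suc x) y \<omega> = q powi height v h x (Suc y) \<omega> / q ^ (v x y \<omega> + h x y \<omega>)"
    using assms 2 by (simp add: height_Suc_left power_int_diff power_add)
  show ?case
    unfolding xi_def using 1 2 3 by (simp add: diff_divide_distrib add_divide_distrib algebra_simps)
qed

lemma integrable_xi:
  assumes "q > 0"
  shows "integrable M (xi I J q \<alpha> (height v h) x y)"
  unfolding xi_def[abs_def]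
  by (intro Bochner_Integration.integrable_add Bochner_Integration.integrable_diff
      integrable_mult_right integrable_power_height assms)

lemma xi_known:
  assumes "\<And>i. i \<le> x \<Longrightarrow> (i, y) \<in> S" "\<And>i. i \<le> x \<Longrightarrow> y > 0 \<Longrightarrow> (i, y - 1) \<in> S"
  shows "xi I J q \<alpha> (height v h) (x + 1) (y + 1) \<in> borel_measurable (known S)"
proof -
  have "height v h i j \<in> measurable (known S) (count_space UNIV)" if "i \<le> x + 1" "j = y \<or> j = y + 1" for i j
    using that assms by (intro height_known) auto
  note [measurable] = this[of "x + 1" "y + 1"] this[of x "y + 1"] this[of "x + 1" y] this[of x y]
  show ?thesis unfolding xi_def[abs_def] add_diff_cancel_right' by measurable
qed

section \<open>Orthogonality of \<open>xi\<close> to growing \<sigma>-algebras\<close>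

text \<open>In \<open>xi_eq\<close>, the power \<open>1 / q ^ v x (y + 1)\<close> is expanded over
  the finitely many outputs and the indicators are exchanged for weights;
  \<open>vertex_weight_moment\<close> then returns exactly the subtracted term.\<close>

lemma xi_zero_earlier:
  assumes q: "q > 0" "q \<noteq> 1" and \<alpha>: "\<alpha> \<noteq> 0"
    and nz: "\<forall>t<I + J. \<alpha> * q ^ t \<noteq> - 1" and "I \<ge> 1"
    and A: "A \<in> sets (known (earlier x y))"
  shows "set_lebesgue_integral M A (xi I J q \<alpha> (height v h) (x + 1) (y + 1)) = 0"
proof -
  define c where "c i1 j1 = ((\<alpha> + nu I q) + (1 + \<alpha> * q ^ J) / q ^ (i1 + j1) - (nu I q + \<alpha> * q ^ J) / q ^ j1) / (1 + \<alpha>)" for i1 j1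
  \<comment> \<open>\<open>f\<close> collects what is known before \<open>(x, y)\<close>: the height
    at \<open>(x, y + 1)\<close> uses, besides the boundary, only the vertices \<open>(i, y)\<close>
    with \<open>i < x\<close>.\<close>
  define f where "f \<omega> = indicator A \<omega> * q powi height v h x (y + 1) \<omega>" for \<omega>
  have AM [measurable]: "A \<in> sets M" using A sets_known_subset by auto
  have [measurable]: "height v h x (y + 1) \<in> measurable (known (earlier x y)) (count_space UNIV)"
    by (rule height_known) (auto simp: earlier_def)
  have f: "f \<in> borel_measurable (known (earlier x y))"
    unfolding f_def[abs_def] using A by measurable
  have fi: "integrable M f"
    unfolding f_def[abs_def]
    using integrable_mult_indicator[OF AM integrable_power_height[OF q(1), of x "y + 1"]] by simp
  have [measurable]: "f \<in> borel_measurable M" using fi by simp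
  have fF: "integrable M (\<lambda>\<omega>. f \<omega> * F (v x' y' \<omega>) (h x'' y'' \<omega>))" for F :: "nat \<Rightarrow> nat \<Rightarrow> real" and x' y' x'' y''
    by (rule integrable_mult_bounded_nat2[OF fi]) (use v_le h_le in auto)
  have "set_lebesgue_integral M A (xi I J q \<alpha> (height v h) (x + 1) (y + 1)) =
      (\<integral>\<omega>. f \<omega> * (1 / q ^ v x (y + 1) \<omega>) - f \<omega> * c (v x y \<omega>) (h x y \<omega>) \<partial>M)"
    unfolding set_lebesgue_integral_def
  proof (rule integral_cong_AE)
    show "AE \<omega> in M. indicator A \<omega> *\<^sub>R xi I J q \<alpha> (height v h) (x + 1) (y + 1) \<omega> =
        f \<omega> * (1 / q ^ v x (y + 1) \<omega>) - f \<omega> * c (v x y \<omega>) (h x y \<omega>)"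
      using xi_eq[OF q(1), of x y] 
      by eventually_elim (auto simp: f_def c_def indicator_def)
  qed (use integrable_xi[OF q(1)] fF[of "\<lambda>i j. 1 / q ^ i" x "y + 1" x y] fF[of c x y x y] in auto)
  also have "\<dots> = (\<integral>\<omega>. f \<omega> * (1 / q ^ v x (y + 1) \<omega>) \<partial>M) - (\<integral>\<omega>. f \<omega> * c (v x y \<omega>) (h x y \<omega>) \<partial>M)"
    by (rule Bochner_Integration.integral_diff) (rule fF[of "\<lambda>i j. 1 / q ^ i" x "y + 1" x y] fF)+
  also have "(\<integral>\<omega>. f \<omega> * (1 / q ^ v x (y + 1) \<omega>) \<partial>M) =
      (\<integral>\<omega>. (\<Sum>i2\<le>I. \<Sum>j2\<le>J. 1 / q ^ i2 * (f \<omega> * of_bool (v x (y + 1) \<omega> = i2 \<and> h (x + 1) y \<omega> = j2))) \<partial>M)"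
  proof (rule Bochner_Integration.integral_cong)
    fix \<omega> assume "\<omega> \<in> space M"
    then have "1 / q ^ v x (y + 1) \<omega> = (\<Sum>i2\<le>I. \<Sum>j2\<le>J. 1 / q ^ i2 * of_bool (v x (y + 1) \<omega> = i2 \<and> h (x + 1) y \<omega> = j2))"
      by (intro sum_of_bool_pair[where F = "\<lambda>i j. 1 / q ^ i"] v_le h_le)
    then show "f \<omega> * (1 / q ^ v x (y + 1) \<omega>) = (\<Sum>i2\<le>I. \<Sum>j2\<le>J. 1 / q ^ i2 * (f \<omega> * of_bool (v x (y + 1) \<omega> = i2 \<and> h (x + 1) y \<omega> = j2)))"
      by (simp add: sum_distrib_left mult_ac)
  qed simp
  also have "\<dots> = (\<Sum>i2\<le>I. \<Sum>j2\<le>J. 1 / q ^ i2 * (\<integral>\<omega>. f \<omega> * of_bool (v x (y + 1) \<omega> = i2 \<and> h (x + 1) y \<omega> = j2) \<partial>M))"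
    using fF[of "\<lambda>i j. of_bool (i = _ \<and> j = _)" x "y + 1" "x + 1" y]
    by (subst Bochner_Integration.integral_sum Bochner_Integration.integral_mult_right_zero | simp)+
  also have "\<dots> = (\<Sum>i2\<le>I. \<Sum>j2\<le>J. 1 / q ^ i2 * (\<integral>\<omega>. f \<omega> * vertex_weight I J q \<alpha> (v x y \<omega>) (h x y \<omega>) i2 j2 \<partial>M))"
    using integral_output_indicator[OF f fi] by simp
  also have "\<dots> = (\<integral>\<omega>. (\<Sum>i2\<le>I. \<Sum>j2\<le>J. 1 / q ^ i2 * (f \<omega> * vertex_weight I J q \<alpha> (v x y \<omega>) (h x y \<omega>) i2 j2)) \<partial>M)"
    using fF[of "\<lambda>i j. vertex_weight I J q \<alpha> i j _ _" x y x y]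
    by (subst Bochner_Integration.integral_sum Bochner_Integration.integral_mult_right_zero | simp)+
  also have "\<dots> = (\<integral>\<omega>. f \<omega> * c (v x y \<omega>) (h x y \<omega>) \<partial>M)"
  proof (rule Bochner_Integration.integral_cong)
    fix \<omega> assume \<omega>: "\<omega> \<in> space M"
    show "(\<Sum>i2\<le>I. \<Sum>j2\<le>J. 1 / q ^ i2 * (f \<omega> * vertex_weight I J q \<alpha> (v x y \<omega>) (h x y \<omega>) i2 j2)) =
        f \<omega> * c (v x y \<omega>) (h x y \<omega>)"
      unfolding c_def sum_distrib_left
        vertex_weight_moment[OF q \<alpha> nz \<open>I \<ge> 1\<close> v_le[OF \<omega>] h_le[OF \<omega>], of x y x y, symmetric]
      by (intro sum.cong refl) simp
  qed simp
  finally show ?thesis by simp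
qed


text \<open>Both \<open>Z\<close> and \<open>known S\<close> are determined before
  \<open>(a, b)\<close> is sampled, so its outputs may be replaced by weights, which are functions
  of the inputs. The inputs are measurable for \<open>known S\<close>, to which \<open>Z\<close> is
  already orthogonal.\<close>

lemma zero_integral_add_vertex:
  fixes Z :: "'a \<Rightarrow> real"
  assumes Z: "integrable M Z" "Z \<in> borel_measurable (known (earlier a b))"
    and S: "S \<subseteq> earlier a b"
    and inputs: "b > 0 \<Longrightarrow> (a, b - 1) \<in> S" "a > 0 \<Longrightarrow> (a - 1, b) \<in> S"
    and zero: "\<And>A. A \<in> sets (known S) \<Longrightarrow> set_lebesgue_integral M A Z = 0"
    and A: "A \<in> sets (known (insert (a, b) S))"
  shows "set_lebesgue_integral M A Z = 0"
proof -
  \<comment> \<open>An intersection-stable class whose \<sigma>-algebra contains the enlarged one: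
    \<open>C = UNIV\<close> gives the sets of \<open>known S\<close>, and \<open>B = space M\<close>
    the events of the new outputs.\<close>
  define E where "E = {B \<inter> {\<omega> \<in> space M. (v a (b + 1) \<omega>, h (a + 1) b \<omega>) \<in> C} | B C. B \<in> sets (known S)}"
  have E_I: "B \<inter> {\<omega> \<in> space M. (v a (b + 1) \<omega>, h (a + 1) b \<omega>) \<in> C} \<in> E" if "B \<in> sets (known S)" for B C
    using that by (auto simp: E_def)
  have Z0: "(\<integral>\<omega>. Z \<omega> \<partial>M) = 0"
    using zero[OF sets.top] set_integral_space[OF Z(1)] by simp
  have EM: "E \<subseteq> sets M"
    using sets_known_subset[of S] by (auto simp: E_def)
  have "Int_stable E"
  proof (rule Int_stableI)
    fix B B' assume "B \<in> E" "B' \<in> E"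
    then obtain D C D' C' where "D \<in> sets (known S)" "D' \<in> sets (known S)"
      "B = D \<inter> {\<omega> \<in> space M. (v a (b + 1) \<omega>, h (a + 1) b \<omega>) \<in> C}"
      "B' = D' \<inter> {\<omega> \<in> space M. (v a (b + 1) \<omega>, h (a + 1) b \<omega>) \<in> C'}"
      unfolding E_def by blast
    then show "B \<inter> B' \<in> E"
      using E_I[of "D \<inter> D'" "C \<inter> C'"] by (auto simp: Int_def conj_ac)
  qed
  moreover have "set_lebesgue_integral M B Z = 0" if "B \<in> E" for B
  proof -
    from that obtain D C where D: "D \<in> sets (known S)"
      and B: "B = D \<inter> {\<omega> \<in> space M. (v a (b + 1) \<omega>, h (a + 1) b \<omega>) \<in> C}"
      unfolding E_def by blast
    define f where "f \<omega> = indicator D \<omega> * Z \<omega>" for \<omega>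
    have DM: "D \<in> sets M" and DE: "D \<in> sets (known (earlier a b))"
      using D sets_known_subset[of S] sets_known_mono[OF S] by auto
    have f: "f \<in> borel_measurable (known (earlier a b))"
      unfolding f_def[abs_def] using DE Z(2) by measurable
    have fi: "integrable M f"
      unfolding f_def[abs_def] using integrable_mult_indicator[OF DM Z(1)] by simp
    \<comment> \<open>Fixing the values of the inputs cuts out a set of \<open>known S\<close>, so
      \<open>zero\<close> applies.\<close>
    have f0: "(\<integral>\<omega>. f \<omega> * of_bool (v a b \<omega> = i1 \<and> h a b \<omega> = j1) \<partial>M) = 0" for i1 j1
    proof -
      have [measurable]: "v a b \<in> measurable (known S) (count_space UNIV)"
         "h a b \<in> measurable (known S) (count_space UNIV)"
        using inputs by (auto intro!: v_known h_known)
      have "{\<omega> \<in> space (known S). v a b \<omega> = i1 \<and> h a b \<omega> = j1} \<in> sets (known S)" by measurable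
      then have "D \<inter> {\<omega> \<in> space M. v a b \<omega> = i1 \<and> h a b \<omega> = j1} \<in> sets (known S)"
        using D by auto
      from zero[OF this] show ?thesis
        unfolding set_lebesgue_integral_def
        by (subst Bochner_Integration.integral_cong[OF refl]) (auto simp: f_def indicator_def)
    qed
    have out0: "(\<integral>\<omega>. f \<omega> * of_bool (v a (b + 1) \<omega> = i2 \<and> h (a + 1) b \<omega> = j2) \<partial>M) = 0"
      if "i2 \<le> I" "j2 \<le> J" for i2 j2
      unfolding integral_output_indicator[OF f fi that]
      by (rule zero_integral_mult_nat2[OF fi v_measurable h_measurable v_le h_le f0])
    have "(\<integral>\<omega>. f \<omega> * of_bool ((v a (b + 1) \<omega>, h (a + 1) b \<omega>) \<in> C) \<partial>M) = 0"
      by (rule zero_integral_mult_nat2[where F = "\<lambda>i j. of_bool ((i, j) \<in> C)",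
            OF fi v_measurable h_measurable v_le h_le out0])
    then show ?thesis
      unfolding set_lebesgue_integral_def B
      by (subst Bochner_Integration.integral_cong[OF refl]) (auto simp: f_def indicator_def)
  qed
  moreover have "A \<in> sigma_sets (space M) E"
  proof -
    have gen: "sets (sigma (space M) E) = sigma_sets (space M) E" "space (sigma (space M) E) = space M"
      using EM sets.sets_into_space by (auto intro!: sets_measure_of space_measure_of)
    have "sets (known S) \<subseteq> E"
      using E_I[of _ UNIV] sets.sets_into_space[of _ "known S"] by (auto simp: Int_absorb2)
    then have S': "sets (known S) \<subseteq> sets (sigma (space M) E)"
      unfolding gen by auto
    have "subalgebra (sigma (space M) E) (known S)"
      using S' gen(2) by (simp add: subalgebra_def)
    note old = measurable_from_subalg[OF this measurable_generated_by[of _ "known_variables v h S" M, folded known_def]]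
    have out: "{\<omega> \<in> space M. (v a (b + 1) \<omega>, h (a + 1) b \<omega>) \<in> C} \<in> sigma_sets (space M) E" for C
      using E_I[OF sets.top, of C] by (simp add: Int_def conj_ac sigma_sets.Basic)
    have v_out: "v a (b + 1) \<in> measurable (sigma (space M) E) (count_space UNIV)"
    proof (rule measurableI)
      show "v a (b + 1) -` C \<inter> space (sigma (space M) E) \<in> sets (sigma (space M) E)" for C
        using out[of "C \<times> UNIV"] unfolding gen by (simp add: vimage_def Int_def conj_commute)
    qed simp
    have h_out: "h (a + 1) b \<in> measurable (sigma (space M) E) (count_space UNIV)"
    proof (rule measurableI)
      show "h (a + 1) b -` C \<inter> space (sigma (space M) E) \<in> sets (sigma (space M) E)" for C
        using out[of "UNIV \<times> C"] unfolding gen by (simp add: vimage_def Int_def conj_commute)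
    qed simp
    have "sets (known (insert (a, b) S)) \<subseteq> sets (sigma (space M) E)"
      unfolding known_def
    proof (intro sets_generated_by_subset)
      fix X assume "X \<in> known_variables v h (insert (a, b) S)"
      then have "X \<in> known_variables v h S \<or> X = v a (b + 1) \<or> X = h (a + 1) b" by blast
      then show "X \<in> measurable (sigma (space M) E) (count_space UNIV)"
        using v_out h_out old by blast
    qed (simp add: gen)
    then show ?thesis using A gen by auto
  qed
  ultimately show ?thesis
    using zero_integral_sigma_sets[OF Z(1) _ EM _ Z0] by blast
qed

text \<open>The outer induction runs over the diagonals, the inner one over the finitely many
  vertices of the past on the new diagonal.\<close>

lemma xi_zero_past_upto:
  assumes q: "q > 0" "q \<noteq> 1" and \<alpha>: "\<alpha> \<noteq> 0"
    and nz: "\<forall>t<I + J. \<alpha> * q ^ t \<noteq> - 1" and "I \<ge> 1"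
    and "x + y \<le> N" "A \<in> sets (known (past x y \<inter> {(a, b). a + b \<le> N}))"
  shows "set_lebesgue_integral M A (xi I J q \<alpha> (height v h) (x + 1) (y + 1)) = 0"
  using assms(6,7)
proof (induction N arbitrary: A rule: dec_induct)
  case base
  \<comment> \<open>Since \<open>(x, y)\<close> is not in its own past, only earlier vertices occur
    up to its diagonal.\<close>
  have "past x y \<inter> {(a, b). a + b \<le> x + y} \<subseteq> earlier x y"
    by (auto simp: past_def earlier_def)
  then show ?case
    using xi_zero_earlier[OF q \<alpha> nz \<open>I \<ge> 1\<close>] sets_known_mono base by blast
next
  case (step N)
  let ?S = "past x y \<inter> {(a, b). a + b \<le> N}"
  have "set_lebesgue_integral M A (xi I J q \<alpha> (height v h) (x + 1) (y + 1)) = 0"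
    if "finite T" "T \<subseteq> past x y \<inter> {(a, b). a + b = Suc N}" "A \<in> sets (known (?S \<union> T))" for T A
    using that
  proof (induction T arbitrary: A rule: finite_induct)
    case empty
    then show ?case using step.IH by simp
  next
    case (insert p T)
    obtain a b where p: "p = (a, b)" by force
    with insert have ab: "(a, b) \<in> past x y" "a + b = Suc N" "(a, b) \<notin> T" by auto
    show ?case
    proof (rule zero_integral_add_vertex[of _ a b "?S \<union> T"])
      \<comment> \<open>Here \<open>x + y < a + b\<close>, so the vertices that determine
        \<open>xi\<close> lie on diagonals strictly before that of \<open>(a, b)\<close>.\<close>
      show "xi I J q \<alpha> (height v h) (x + 1) (y + 1) \<in> borel_measurable (known (earlier a b))"
        using ab step.hyps by (intro xi_known) (auto simp: earlier_def)
      show "A \<in> sets (known (insert (a, b) (?S \<union> T)))" using insert.prems p by simp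
      show "set_lebesgue_integral M B (xi I J q \<alpha> (height v h) (x + 1) (y + 1)) = 0"
        if "B \<in> sets (known (?S \<union> T))" for B
        using insert.IH[OF _ that] insert.prems(1) by blast
      show "?S \<union> T \<subseteq> earlier a b" using ab insert.prems(1) by (auto simp: earlier_def)
    \<comment> \<open>The inputs of \<open>(a, b)\<close> come from its left and lower neighbours,
      which lie on diagonal \<open>N\<close> and inherit membership in the past.\<close>
    qed (use ab in \<open>auto simp: past_def intro: integrable_xi[OF q(1)]\<close>)
  qed
  moreover have "finite (past x y \<inter> {(a, b). a + b = Suc N})"
    by (rule finite_subset[of _ "{..Suc N} \<times> {..Suc N}"]) auto
  moreover have "?S \<union> (past x y \<inter> {(a, b). a + b = Suc N}) = past x y \<inter> {(a, b). a + b \<le> Suc N}"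
    by auto
  ultimately show ?case using step.prems by (metis order_refl)
qed

text \<open>The union of the increasing \<sigma>-algebras over all diagonals is intersection-stable
  but need not be a \<sigma>-algebra, so the Dynkin argument is applied once more.\<close>

lemma xi_zero_past:
  assumes q: "q > 0" "q \<noteq> 1" and \<alpha>: "\<alpha> \<noteq> 0"
    and nz: "\<forall>t<I + J. \<alpha> * q ^ t \<noteq> - 1" and "I \<ge> 1"
    and A: "A \<in> sets (known (past x y))"
  shows "set_lebesgue_integral M A (xi I J q \<alpha> (height v h) (x + 1) (y + 1)) = 0"
proof -
  let ?Z = "xi I J q \<alpha> (height v h) (x + 1) (y + 1)"
  define G where "G N = sets (known (past x y \<inter> {(a, b). a + b \<le> x + y + N}))" for N
  have mono: "G m \<subseteq> G n" if "m \<le> n" for m n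
    unfolding G_def using that by (intro sets_known_mono) auto
  have zero: "set_lebesgue_integral M B ?Z = 0" if "B \<in> (\<Union>N. G N)" for B
  proof -
    from that obtain N where "B \<in> G N" by blast
    then show ?thesis
      unfolding G_def by (intro xi_zero_past_upto[OF q \<alpha> nz \<open>I \<ge> 1\<close>, of x y "x + y + N"]) auto
  qed
  have EM: "(\<Union>N. G N) \<subseteq> sets M" using sets_known_subset by (auto simp: G_def)
  have gen: "sets (sigma (space M) (\<Union>N. G N)) = sigma_sets (space M) (\<Union>N. G N)"
      "space (sigma (space M) (\<Union>N. G N)) = space M"
    using EM sets.sets_into_space by (auto intro!: sets_measure_of space_measure_of)
  have "Int_stable (\<Union>N. G N)"
  proof (rule Int_stableI)
    fix B C assume "B \<in> (\<Union>N. G N)" "C \<in> (\<Union>N. G N)"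
    then obtain m n where "B \<in> G m" "C \<in> G n" by auto
    then have "B \<in> G (max m n)" "C \<in> G (max m n)"
      using mono[of m "max m n"] mono[of n "max m n"] by auto
    then have "B \<inter> C \<in> G (max m n)" unfolding G_def by (rule sets.Int)
    then show "B \<inter> C \<in> (\<Union>N. G N)" by auto
  qed
  moreover have "(\<integral>\<omega>. ?Z \<omega> \<partial>M) = 0"
  proof -
    have "space M \<in> G 0" unfolding G_def by (metis sets.top space_known)
    then show ?thesis using zero[of "space M"] set_integral_space[OF integrable_xi[OF q(1)]] by auto
  qed
  moreover have "A \<in> sigma_sets (space M) (\<Union>N. G N)"
  proof -
    have "sets (known (past x y)) \<subseteq> sets (sigma (space M) (\<Union>N. G N))"
      unfolding known_def
    proof (rule sets_generated_by_subset)
      fix X assume "X \<in> known_variables v h (past x y)"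
      then obtain i j where "X \<in> known_variables v h (past x y \<inter> {(i, j)})"
        by (rule known_variables_single)
      \<comment> \<open>The bound \<open>x + y + (i + j)\<close> is a crude one that includes the
        vertex \<open>(i, j)\<close> and matches the indexing of \<open>G\<close>.\<close>
      then have "X \<in> known_variables v h (past x y \<inter> {(a, b). a + b \<le> x + y + (i + j)})"
        by (rule subsetD[OF known_variables_mono, rotated]) auto
      then have X: "X \<in> measurable (known (past x y \<inter> {(a, b). a + b \<le> x + y + (i + j)})) (count_space UNIV)"
        unfolding known_def by (rule measurable_generated_by)
      have "G (i + j) \<subseteq> sets (sigma (space M) (\<Union>N. G N))" unfolding gen by auto
      then have "subalgebra (sigma (space M) (\<Union>N. G N)) (known (past x y \<inter> {(a, b). a + b \<le> x + y + (i + j)}))"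
        using gen(2) by (simp add: subalgebra_def G_def)
      then show "X \<in> measurable (sigma (space M) (\<Union>N. G N)) (count_space UNIV)"
        using X by (rule measurable_from_subalg)
    qed (simp add: gen)
    then show ?thesis using A gen by auto
  qed
  ultimately show ?thesis
    using zero_integral_sigma_sets[OF integrable_xi[OF q(1)] _ EM zero] by blast
qed

text \<open>This reduces the theorem to \<open>past x y\<close>, since integrals vanishing on a
  larger \<sigma>-algebra vanish on a smaller one.\<close>

lemma sets_filt_subset: "sets (filt M (height v h) x y) \<subseteq> sets (known (past x y))"
  unfolding filt_def
  by (rule sets_generated_by_subset) (auto intro!: height_known simp: past_def)

end

theorem theorem2p3:
  fixes M :: "'a measure" and I J :: nat and q \<alpha> :: real
    and v h :: "nat \<Rightarrow> nat \<Rightarrow> 'a \<Rightarrow> nat" and x y :: nat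
  assumes "I \<ge> 1" and "J \<ge> 1"
    and "(0 < q \<and> q < 1 \<and> \<alpha> < - (q powi (- int I - int J + 1))) \<or>
         (q > 1 \<and> - (q powi (- int I - int J + 1)) < \<alpha> \<and> \<alpha> < 0)"
    and "shs6v M I J q \<alpha> v h"
  shows "integrable M (xi I J q \<alpha> (height v h) (x + 1) (y + 1)) \<and>
    (AE \<omega> in M. real_cond_exp M (filt M (height v h) x y)
       (xi I J q \<alpha> (height v h) (x + 1) (y + 1)) \<omega> = 0)"
proof -
  interpret shs6v M I J q \<alpha> v h by (rule assms(4))
  have q: "q > 0" "q \<noteq> 1" using assms(3) by auto
  then have "q powi (- int I - int J + 1) > 0" by simp
  then have \<alpha>: "\<alpha> \<noteq> 0" using assms(3) by force
  \<comment> \<open>These are the zeros to be avoided in the denominators of the weights. The bound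
    on \<alpha> is tailored to \<open>t = I + J - 1\<close>, where it reads
    \<open>\<alpha> * q ^ t < - 1\<close> or \<open>\<alpha> * q ^ t > - 1\<close>; smaller
    \<open>t\<close> move further to the same side.\<close>
  have nz: "\<forall>t<I + J. \<alpha> * q ^ t \<noteq> - 1"
  proof (intro allI impI)
    fix t assume that: "t < I + J"
    have *: "q powi (- int I - int J + 1) * q ^ t = q powi (- int (I + J - 1 - t))"
      using q assms(1) that by (simp add: of_nat_diff algebra_simps flip: power_int_of_nat power_int_add)
    from assms(3) show "\<alpha> * q ^ t \<noteq> - 1"
    proof (elim disjE conjE)
      assume "q < 1" "\<alpha> < - (q powi (- int I - int J + 1))"
      then have "\<alpha> * q ^ t < - (q powi (- int I - int J + 1)) * q ^ t"
        using q by (intro mult_strict_right_mono) auto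
      also have "\<dots> \<le> - 1"
        using q \<open>q < 1\<close> unfolding minus_mult_left[symmetric] *
        by (simp add: power_int_minus one_le_inverse_iff power_le_one)
      finally show ?thesis by simp
    next
      assume "q > 1" "- (q powi (- int I - int J + 1)) < \<alpha>"
      then have "- (q powi (- int I - int J + 1)) * q ^ t < \<alpha> * q ^ t"
        using q by (intro mult_strict_right_mono) auto
      moreover have "- 1 \<le> - (q powi (- int I - int J + 1)) * q ^ t"
        using q \<open>q > 1\<close> unfolding minus_mult_left[symmetric] *
        by (simp add: power_int_minus inverse_le_1_iff)
      ultimately show ?thesis by simp
    qed
  qed
  have "space (filt M (height v h) x y) = space M" by (simp add: filt_def)
  then have "subalgebra M (filt M (height v h) x y)"
    using sets_filt_subset[of x y] sets_known_subset[of "past x y"] by (auto simp: subalgebra_def)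
  then interpret F: finite_measure_subalgebra M "filt M (height v h) x y"
    by unfold_locales
  have "AE \<omega> in M. real_cond_exp M (filt M (height v h) x y)
       (xi I J q \<alpha> (height v h) (x + 1) (y + 1)) \<omega> = 0"
  \<comment> \<open>The zero function is measurable, so it is enough to compare integrals over the
    sets of \<open>filt\<close>.\<close>
  proof (rule F.real_cond_exp_charact)
    fix A assume "A \<in> sets (filt M (height v h) x y)"
    then show "set_lebesgue_integral M A (xi I J q \<alpha> (height v h) (x + 1) (y + 1)) =
        (\<integral>\<omega>\<in>A. 0 \<partial>M)"
      using sets_filt_subset[of x y] xi_zero_past[OF q \<alpha> nz assms(1)]
      by (auto simp: set_lebesgue_integral_def)
  qed (use integrable_xi[OF q(1)] in auto)
  then show ?thesis using integrable_xi[OF q(1)] by blast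
qed

end
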